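(* (i) Let $\gamma>0$ and $\varepsilon>0$. Then for any graph $G_n$ on $n$ vertices with at least $\gamma n^2$ edges and any $p=p(n)\geq n^{-1/2+\varepsilon}$, asymptotically almost surely $G_n\cup G(n,p)\rightarrow(K_4)$. (ii) For $0<\gamma<\frac14$ there exists (for each $n$) a graph $G_n$ on $n$ vertices with at least $\gamma n^2$ edges such that for $p=p(n)=o(n^{-1/2})$, asymptotically almost surely $G_n\cup G(n,p)\not\rightarrow(K_4)$.
   Context: $G(n,p)$ is the binomial random graph on the vertex set of $G_n$, each edge present independently with probability $p$; $G_n\cup G(n,p)$ is the union of edge sets. "Asymptotically almost surely" means with probability tending to $1$ as $n\to\infty$ (in (i), uniformly over all such $G_n$). $G\rightarrow(K_4)$ means every 2-colouring of $E(G)$ contains a monochromatic copy of $K_4$; $G\not\rightarrow(K_4)$ is its negation.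
   Formalization: In (ii), the bound of at least γn² edges is asserted only for n ≥ 2, since a graph on n = 1 vertex has no edges and so cannot have γ > 0 edges. *)

theory Defs
  imports "HOL-Library.Ramsey" "HOL-Library.Landau_Symbols" "HOL-Probability.Product_PMF"
begin

text \<open>
  A simple graph is given by its vertex set \<open>V\<close> and its edge set \<open>E\<close>, a set of
  two-element subsets of \<open>V\<close>; \<open>[V]\<^bsup>2\<^esup>\<close> is the edge set of the complete graph on \<open>V\<close>.
\<close>

definition simple_graph :: "'a set \<Rightarrow> 'a set set \<Rightarrow> bool" where
  "simple_graph V E \<longleftrightarrow> finite V \<and> E \<subseteq> [V]\<^bsup>2\<^esup>"

definition has_complete_subgraph :: "'a set \<Rightarrow> 'a set set \<Rightarrow> nat \<Rightarrow> bool" where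
  "has_complete_subgraph V E k \<longleftrightarrow> (\<exists>S \<in> [V]\<^bsup>k\<^esup>. clique S E)"

text \<open>
  \<open>G \<rightarrow> (K\<^sub>k)\<close> for \<open>G = (V, E)\<close>. The two colours are the values of type \<^typ>\<open>bool\<close>; the colouring
  \<open>c\<close> is a total function, but only its values on \<open>E\<close> matter.
\<close>

definition ramsey_arrow :: "'a set \<Rightarrow> 'a set set \<Rightarrow> nat \<Rightarrow> bool" where
  "ramsey_arrow V E k \<longleftrightarrow>
     (\<forall>c :: 'a set \<Rightarrow> bool. \<exists>i. has_complete_subgraph V {e \<in> E. c e = i} k)"

text \<open>
  The edge set of the binomial random graph on the finite vertex set \<open>V\<close>. It is meaningful for
  \<open>0 \<le> p \<le> 1\<close> only, since \<^const>\<open>bernoulli_pmf\<close> replaces other parameters by a value in that range.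
\<close>

definition binomial_random_graph :: "'a set \<Rightarrow> real \<Rightarrow> 'a set set pmf" where
  "binomial_random_graph V p =
     map_pmf (\<lambda>b. {e \<in> [V]\<^bsup>2\<^esup>. b e}) (Pi_pmf ([V]\<^bsup>2\<^esup>) False (\<lambda>_. bernoulli_pmf p))"

end

theory Submission
  imports Defs "HOL-Real_Asymp.Real_Asymp"
begin

text \<open>
  (i) For \<open>p \<ge> n^(- 1/2 + \<epsilon>)\<close> asymptotically almost surely every set of \<open>s = n^(1 - e)\<close> vertices spans
  a \<open>K\<^sub>4\<close> of the random graph \<open>R\<close>: the probability that a given set does not is \<open>exp (- n^(1 + c))\<close>, which beats
  the \<open>2\<^sup>n\<close> sets. Given a colouring, apply dependent random choice to the majority colour \<open>i\<close> of \<open>G\<close> to get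
  a set \<open>U\<close> of \<open>s\<close> vertices in which any two have \<open>s\<close> common neighbours in colour \<open>i\<close>. A \<open>K\<^sub>4\<close> of
  \<open>R\<close> inside \<open>U\<close> avoids colour \<open>i\<close> unless it has an edge \<open>ab\<close> of colour \<open>i\<close>; then a \<open>K\<^sub>4\<close> of \<open>R\<close> inside the
  common neighbourhood of \<open>a\<close> and \<open>b\<close> avoids colour \<open>i\<close> unless one of its edges completes \<open>ab\<close> to a \<open>K\<^sub>4\<close>
  of colour \<open>i\<close>.

  (ii) Take \<open>G\<close> balanced complete bipartite with parts \<open>A\<close> and \<open>B\<close>. Suppose that \<open>R\<close> on \<open>A\<close> has a colouring
  without monochromatic triangle and that some \<open>W\<close> contains one or two vertices of every \<open>K\<^sub>4\<close> of \<open>R\<close> on \<open>B\<close>.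
  Colour the edges in \<open>B\<close> touching \<open>W\<close> and the edges between \<open>A\<close> and \<open>B - W\<close> red, all other edges touching \<open>B\<close>
  blue; there is no monochromatic \<open>K\<^sub>4\<close>. For \<open>p \<le> c n^(- 1/2)\<close> with \<open>c\<close> small, the clusters of triangles
  of \<open>R\<close> sharing edges and of copies of \<open>K\<^sub>4\<close> sharing vertices are subcritical, hence of size
  \<open>O (log n)\<close>, and sets of that size span fewer than \<open>5/2\<close> edges per vertex. So each cluster is
  4-degenerate and 5-colourable, and both structures are pulled back from \<open>K\<^sub>5\<close>: its decomposition into two
  pentagons, and two of its five vertices.
\<close>

subsection \<open>Random subsets of a finite set\<close>

text \<open>The ground set is arbitrary rather than the set of all pairs, so that inductions can add
  its elements one at a time.\<close>

definition percolation :: "'a set \<Rightarrow> real \<Rightarrow> 'a set pmf" where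
  "percolation D p = map_pmf (\<lambda>b. {e \<in> D. b e}) (Pi_pmf D False (\<lambda>_. bernoulli_pmf p))"

lemma binomial_random_graph_percolation:
  "binomial_random_graph V p = percolation ([V]\<^bsup>2\<^esup>) p"
  by (simp add: binomial_random_graph_def percolation_def)

lemma set_percolation: "finite D \<Longrightarrow> R \<in> set_pmf (percolation D p) \<Longrightarrow> R \<subseteq> D"
  by (auto simp: percolation_def)

lemma prob_percolation_cong:
  assumes "finite D" "\<And>R. R \<subseteq> D \<Longrightarrow> P R \<longleftrightarrow> Q R"
  shows "measure_pmf.prob (percolation D p) {R. P R} = measure_pmf.prob (percolation D p) {R. Q R}"
  by (rule measure_pmf.finite_measure_eq_AE)
    (auto simp: AE_measure_pmf_iff assms(2) dest: set_percolation[OF assms(1)])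

lemma prob_percolation_mono:
  assumes "finite D" "\<And>R. R \<subseteq> D \<Longrightarrow> P R \<Longrightarrow> Q R"
  shows "measure_pmf.prob (percolation D p) {R. P R} \<le> measure_pmf.prob (percolation D p) {R. Q R}"
  by (rule measure_pmf.finite_measure_mono_AE)
    (auto simp: AE_measure_pmf_iff assms(2) dest: set_percolation[OF assms(1)])

lemma prob_percolation_union_bound:
  assumes "finite D" "finite I" "\<And>R. R \<subseteq> D \<Longrightarrow> P R \<Longrightarrow> \<exists>i\<in>I. Q i R"
  shows "measure_pmf.prob (percolation D p) {R. P R}
    \<le> (\<Sum>i\<in>I. measure_pmf.prob (percolation D p) {R. Q i R})"
proof -
  have "measure_pmf.prob (percolation D p) {R. P R} \<le> measure_pmf.prob (percolation D p) {R. \<exists>i\<in>I. Q i R}"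
    using assms by (intro prob_percolation_mono) auto
  also have "{R. \<exists>i\<in>I. Q i R} = (\<Union>i\<in>I. {R. Q i R})"
    by auto
  also have "measure_pmf.prob (percolation D p) \<dots> \<le> (\<Sum>i\<in>I. measure_pmf.prob (percolation D p) {R. Q i R})"
    using assms(2) by (intro measure_pmf.finite_measure_subadditive_finite) auto
  finally show ?thesis .
qed

text \<open>Conditioning on whether \<open>x\<close> is present: the recursion behind both the
  superset formula and monotonicity in \<open>p\<close>.\<close>

lemma prob_percolation_insert:
  assumes D: "finite D" "x \<notin> D" and p: "0 \<le> p" "p \<le> 1"
  shows "measure_pmf.prob (percolation (insert x D) p) {R. Z R} =
    p * measure_pmf.prob (percolation D p) {R. Z (insert x R)}
    + (1 - p) * measure_pmf.prob (percolation D p) {R. Z R}"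
proof -
  have *: "percolation (insert x D) p =
      bernoulli_pmf p \<bind> (\<lambda>y. map_pmf (\<lambda>R. if y then insert x R else R) (percolation D p))"
    unfolding percolation_def Pi_pmf_insert'[OF D] map_bind_pmf map_return_pmf map_pmf_comp map_pmf_def[symmetric]
    using D by (intro bind_pmf_cong map_pmf_cong refl) (auto simp: set_Pi_pmf)
  have "emeasure (percolation (insert x D) p) {R. Z R} =
      emeasure (percolation D p) {R. Z (insert x R)} * p
      + emeasure (percolation D p) {R. Z R} * (1 - p)"
    unfolding * using p by (simp add: vimage_def)
  then have "ennreal (measure_pmf.prob (percolation (insert x D) p) {R. Z R}) =
      ennreal (measure_pmf.prob (percolation D p) {R. Z (insert x R)} * p
        + measure_pmf.prob (percolation D p) {R. Z R} * (1 - p))"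
    unfolding measure_pmf.emeasure_eq_measure using p by (simp add: ennreal_mult)
  then show ?thesis
    using p by (subst (asm) ennreal_inj) (auto simp: mult.commute)
qed

lemma prob_percolation_mem:
  assumes D: "finite D" "x \<in> D" and p: "0 \<le> p" "p \<le> 1"
  shows "measure_pmf.prob (percolation D p) {R. x \<in> R \<and> Z R} =
    p * measure_pmf.prob (percolation D p) {R. Z (insert x R)}"
proof -
  obtain D' where D': "D = insert x D'" "x \<notin> D'" "finite D'"
    using D by (metis Set.set_insert finite_insert)
  have 0: "measure_pmf.prob (percolation D' p) {R. x \<in> R \<and> Z R} = 0"
    using prob_percolation_cong[of D' "\<lambda>R. x \<in> R \<and> Z R" "\<lambda>R. False"] D' by auto
  show ?thesis
    unfolding D'(1) prob_percolation_insert[OF D'(3,2) p] 0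
    by (simp add: algebra_simps)
qed

text \<open>Given \<open>F \<subseteq> R\<close>, the rest of \<open>R\<close> keeps its law, so
  \<open>Z\<close> may be evaluated at \<open>R \<union> F\<close> for an unconditioned
  \<open>R\<close>. The induction moves the elements of \<open>F\<close> one by one into the
  argument of \<open>Z\<close>, hence \<open>Z\<close> is generalised.\<close>

lemma prob_percolation_superset:
  assumes D: "finite D" "F \<subseteq> D" and p: "0 \<le> p" "p \<le> 1"
  shows "measure_pmf.prob (percolation D p) {R. F \<subseteq> R \<and> Z R} =
    p ^ card F * measure_pmf.prob (percolation D p) {R. Z (R \<union> F)}"
proof -
  have "finite F"
    using D finite_subset by blast
  then show ?thesis
    using D(2)
  proof (induction F arbitrary: Z)
    case (insert x F)
    have "measure_pmf.prob (percolation D p) {R. insert x F \<subseteq> R \<and> Z R}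
        = measure_pmf.prob (percolation D p) {R. x \<in> R \<and> (F \<subseteq> R \<and> Z R)}"
      by (simp add: conj_assoc)
    also have "\<dots> = p * measure_pmf.prob (percolation D p) {R. F \<subseteq> R \<and> Z (insert x R)}"
      using insert.prems insert.hyps
      by (subst prob_percolation_mem[OF D(1) _ p]) (auto simp: subset_insert)
    also have "\<dots> = p * (p ^ card F * measure_pmf.prob (percolation D p) {R. Z (insert x (R \<union> F))})"
      using insert by auto
    finally show ?case
      using insert.hyps by simp
  qed simp
qed

lemma prob_percolation_superset_le:
  assumes "finite D" "finite F" "0 \<le> p" "p \<le> 1"
  shows "measure_pmf.prob (percolation D p) {R. F \<subseteq> R} \<le> p ^ card F"
proof (cases "F \<subseteq> D")
  case True
  then show ?thesis
    using prob_percolation_superset[of D F p "\<lambda>_. True"] assms by simp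
next
  case False
  then have "measure_pmf.prob (percolation D p) {R. F \<subseteq> R} = 0"
    using prob_percolation_cong[OF assms(1), of "\<lambda>R. F \<subseteq> R" "\<lambda>_. False"] by auto
  then show ?thesis
    using assms by simp
qed

text \<open>Induction on \<open>D\<close> in place of a coupling: for an increasing \<open>Z\<close>
  the branch containing \<open>x\<close> is at least as likely to satisfy \<open>Z\<close>, and
  raising \<open>q\<close> to \<open>p\<close> moves weight \<open>p - q\<close> onto that
  branch.\<close>

lemma prob_percolation_mono_p:
  assumes "finite D" "0 \<le> q" "q \<le> p" "p \<le> 1" "\<And>R S. R \<subseteq> S \<Longrightarrow> Z R \<Longrightarrow> Z S"
  shows "measure_pmf.prob (percolation D q) {R. Z R} \<le> measure_pmf.prob (percolation D p) {R. Z R}"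
  using assms(1,5)
proof (induction D arbitrary: Z)
  case empty
  then show ?case by (simp add: percolation_def)
next
  case (insert x D)
  let ?P = "\<lambda>p Z. measure_pmf.prob (percolation D p) {R. Z R}"
  have 1: "?P q Z \<le> ?P p Z"
    using insert.prems by (intro insert.IH) auto
  have 2: "?P q (\<lambda>R. Z (insert x R)) \<le> ?P p (\<lambda>R. Z (insert x R))"
    using insert.prems by (intro insert.IH) (meson insert_mono)
  have 3: "?P q Z \<le> ?P q (\<lambda>R. Z (insert x R))"
    using insert.prems insert.hyps by (intro prob_percolation_mono) (auto intro: subset_insertI)
  have "q * ?P q (\<lambda>R. Z (insert x R)) + (1 - q) * ?P q Z
      \<le> p * ?P q (\<lambda>R. Z (insert x R)) + (1 - p) * ?P q Z"
    using mult_nonneg_nonneg[of "p - q" "?P q (\<lambda>R. Z (insert x R)) - ?P q Z"] 3 assms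
    by (simp add: algebra_simps)
  also have "\<dots> \<le> p * ?P p (\<lambda>R. Z (insert x R)) + (1 - p) * ?P p Z"
    using 1 2 assms by (intro add_mono mult_left_mono) auto
  finally show ?case
    using assms insert.hyps by (simp add: prob_percolation_insert)
qed

text \<open>
  A lower-tail bound in the style of Janson. Here the events \<open>E j - E i \<subseteq> R\<close> are principal up-sets, so
  the negative correlation with a decreasing event is immediate from \<open>prob_percolation_superset\<close> and no
  general correlation inequality is needed.
\<close>
lemma prob_percolation_none_le:
  assumes D: "finite D" and p: "0 \<le> p" "p \<le> 1" and I: "finite I"
    and E: "\<And>i. i \<in> I \<Longrightarrow> E i \<subseteq> D \<and> card (E i) = k"
    and dep: "\<And>i. i \<in> I \<Longrightarrow>
      (\<Sum>j\<in>{j\<in>I. j \<noteq> i \<and> E j \<inter> E i \<noteq> {}}. p ^ card (E j - E i)) \<le> 1/2"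
  shows "measure_pmf.prob (percolation D p) {R. \<forall>i\<in>I. \<not> E i \<subseteq> R} \<le> (1 - p ^ k / 2) ^ card I"
  using I subset_refl[of I]
proof (induction I rule: finite_subset_induct')
  case empty
  then show ?case by simp
next
  case (insert i J)
  let ?P = "\<lambda>Z. measure_pmf.prob (percolation D p) {R. Z R}"
  let ?N = "\<lambda>J R. \<forall>j\<in>J. \<not> E j \<subseteq> R"
  \<comment> \<open>The sets indexed by \<open>J0\<close> are disjoint from \<open>E i\<close>, so
    adding \<open>E i\<close> to \<open>R\<close> does not affect their events; only those in
    \<open>J1\<close> can be triggered by it.\<close>
  define J1 where "J1 = {j\<in>J. E j \<inter> E i \<noteq> {}}"
  define J0 where "J0 = J - J1"
  have fin: "finite (E j)" if "j \<in> I" for j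
    using E[OF that] D finite_subset by blast
  have sub: "J \<subseteq> I" "J1 \<subseteq> J" "finite J1"
    using insert I by (auto simp: J1_def intro: finite_subset)
  have J0: "?N J0 (R \<union> E i) \<longleftrightarrow> ?N J0 R" for R
    by (auto simp: J0_def J1_def)
  have 1: "?P (\<lambda>R. ?N J0 R \<and> E j - E i \<subseteq> R) \<le> p ^ card (E j - E i) * ?P (?N J0)" if "j \<in> J1" for j
  proof -
    have jI: "j \<in> I"
      using that sub by auto
    have "?P (\<lambda>R. ?N J0 R \<and> E j - E i \<subseteq> R) = ?P (\<lambda>R. E j - E i \<subseteq> R \<and> ?N J0 R)"
      by (simp add: conj_commute)
    also have "\<dots> = p ^ card (E j - E i) * ?P (\<lambda>R. ?N J0 (R \<union> (E j - E i)))"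
      using E[OF jI] p by (intro prob_percolation_superset D) auto
    also have "\<dots> \<le> p ^ card (E j - E i) * ?P (?N J0)"
      using p by (intro mult_left_mono prob_percolation_mono D) auto
    finally show ?thesis .
  qed
  \<comment> \<open>If \<open>R\<close> avoids \<open>J0\<close> but \<open>R \<union> E i\<close>
    does not avoid \<open>J\<close>, then some \<open>j\<close> in \<open>J1\<close> has its missing
    part \<open>E j - E i\<close> in \<open>R\<close>. By \<open>dep\<close> this takes up at most
    half of the probability.\<close>
  have "?P (?N J0) \<le> ?P (\<lambda>R. ?N J (R \<union> E i)) + (\<Sum>j\<in>J1. ?P (\<lambda>R. ?N J0 R \<and> E j - E i \<subseteq> R))"
  proof -
    have "?P (?N J0) \<le> measure_pmf.prob (percolation D p)
        ({R. ?N J (R \<union> E i)} \<union> (\<Union>j\<in>J1. {R. ?N J0 R \<and> E j - E i \<subseteq> R}))"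
      by (rule measure_pmf.finite_measure_mono) (use J0 in \<open>auto simp: J0_def Diff_subset_conv Un_commute\<close>)
    also have "\<dots> \<le> ?P (\<lambda>R. ?N J (R \<union> E i)) + measure_pmf.prob (percolation D p) (\<Union>j\<in>J1. {R. ?N J0 R \<and> E j - E i \<subseteq> R})"
      by (rule measure_Un_le) auto
    also have "measure_pmf.prob (percolation D p) (\<Union>j\<in>J1. {R. ?N J0 R \<and> E j - E i \<subseteq> R})
       \<le> (\<Sum>j\<in>J1. ?P (\<lambda>R. ?N J0 R \<and> E j - E i \<subseteq> R))"
      using sub by (intro measure_pmf.finite_measure_subadditive_finite) auto
    finally show ?thesis by simp
  qed
  also have "(\<Sum>j\<in>J1. ?P (\<lambda>R. ?N J0 R \<and> E j - E i \<subseteq> R)) \<le> (\<Sum>j\<in>J1. p ^ card (E j - E i)) * ?P (?N J0)"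
    unfolding sum_distrib_right by (intro sum_mono 1)
  also have "\<dots> \<le> 1/2 * ?P (?N J0)"
  proof (intro mult_right_mono)
    have "(\<Sum>j\<in>J1. p ^ card (E j - E i)) \<le> (\<Sum>j\<in>{j\<in>I. j \<noteq> i \<and> E j \<inter> E i \<noteq> {}}. p ^ card (E j - E i))"
      using insert.hyps sub I p by (intro sum_mono2) (auto simp: J1_def)
    also have "\<dots> \<le> 1/2"
      using insert by (intro dep) auto
    finally show "(\<Sum>j\<in>J1. p ^ card (E j - E i)) \<le> 1/2" .
  qed simp
  finally have 2: "?P (?N J0) / 2 \<le> ?P (\<lambda>R. ?N J (R \<union> E i))"
    by simp
  have "?P (?N J) \<le> ?P (?N J0)"
    by (intro prob_percolation_mono D) (auto simp: J0_def)
  then have "p ^ k * (?P (?N J) / 2) \<le> p ^ k * ?P (\<lambda>R. ?N J (R \<union> E i))"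
    using 2 p by (intro mult_left_mono) auto
  also have "\<dots> = ?P (\<lambda>R. E i \<subseteq> R \<and> ?N J R)"
    using prob_percolation_superset[OF D _ p, of "E i" "?N J"] E[of i] insert.hyps insert.prems by auto
  finally have 3: "p ^ k * (?P (?N J) / 2) \<le> ?P (\<lambda>R. E i \<subseteq> R \<and> ?N J R)" .
  \<comment> \<open>Among the outcomes avoiding \<open>J\<close>, a fraction of at least
    \<open>p ^ k / 2\<close> contains \<open>E i\<close>; removing them gives the next
    factor.\<close>
  have "{R. ?N J R} = {R. ?N (insert i J) R} \<union> {R. E i \<subseteq> R \<and> ?N J R}"
    by auto
  then have "?P (?N J) = ?P (?N (insert i J)) + ?P (\<lambda>R. E i \<subseteq> R \<and> ?N J R)"
    by (simp only:) (rule measure_pmf.finite_measure_Union, auto)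
  with 3 have "?P (?N (insert i J)) \<le> (1 - p ^ k / 2) * ?P (?N J)"
    by (simp add: algebra_simps)
  also have "\<dots> \<le> (1 - p ^ k / 2) * (1 - p ^ k / 2) ^ card J"
    using insert.IH power_le_one[of p k] p by (intro mult_left_mono) auto
  finally show ?case
    using insert.hyps by simp
qed

subsection \<open>Cliques in all large sets\<close>

lemma binomial_le_power: "n choose k \<le> n ^ k"
  using binomial_le_pow[of k n] by (cases "k \<le> n") (auto simp: binomial_eq_0)

lemma card_nsets_Int_eq_le:
  assumes "finite V" "finite J"
  shows "card {T \<in> [V]\<^bsup>r\<^esup>. T \<inter> U = J} \<le> card V ^ (r - card J)"
proof -
  have "card {T \<in> [V]\<^bsup>r\<^esup>. T \<inter> U = J} \<le> card ([V]\<^bsup>(r - card J)\<^esup>)"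
  proof (rule card_inj_on_le[where f = "\<lambda>T. T - J"])
    show "inj_on (\<lambda>T. T - J) {T \<in> [V]\<^bsup>r\<^esup>. T \<inter> U = J}"
      by (rule inj_onI) blast
    show "(\<lambda>T. T - J) ` {T \<in> [V]\<^bsup>r\<^esup>. T \<inter> U = J} \<subseteq> [V]\<^bsup>(r - card J)\<^esup>"
      using assms by (auto simp: nsets_def intro!: card_Diff_subset)
  qed (use assms in \<open>auto simp: finite_imp_finite_nsets\<close>)
  also have "\<dots> \<le> card V ^ (r - card J)"
    by (simp add: binomial_le_power)
  finally show ?thesis .
qed

text \<open>Group the sets by their trace \<open>J\<close> on \<open>U\<close>. All of
  \<open>E\<close> lies inside \<open>U\<close>, so every pair of \<open>T\<close> not inside
  \<open>J\<close> is new, and at most \<open>card V ^ (r - card J)\<close> sets have this trace.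
  This serves both the dependency sums for \<open>prob_percolation_none_le\<close> and the search
  steps.\<close>

lemma sum_new_edges_le:
  fixes p :: real
  assumes V: "finite V" and p: "0 \<le> p" "p \<le> 1" and E: "E \<subseteq> [U]\<^bsup>2\<^esup>"
    and T: "\<T> \<subseteq> [V]\<^bsup>r\<^esup>" and J: "finite \<J>" "\<And>T. T \<in> \<T> \<Longrightarrow> T \<inter> U \<in> \<J>" "\<And>J. J \<in> \<J> \<Longrightarrow> finite J"
  shows "(\<Sum>T\<in>\<T>. p ^ card ([T]\<^bsup>2\<^esup> - E))
    \<le> (\<Sum>J\<in>\<J>. real (card V) ^ (r - card J) * p ^ ((r choose 2) - (card J choose 2)))"
proof -
  have fin: "finite \<T>"
    using V T finite_subset finite_imp_finite_nsets by blast
  have "(\<Sum>T\<in>\<T>. p ^ card ([T]\<^bsup>2\<^esup> - E)) \<le> (\<Sum>T\<in>\<T>. p ^ ((r choose 2) - (card (T \<inter> U) choose 2)))"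
  proof (intro sum_mono power_decreasing p)
    fix T assume "T \<in> \<T>"
    then have T': "finite T" "card T = r"
      using T by (auto simp: nsets_def)
    have "(r choose 2) - (card (T \<inter> U) choose 2) = card ([T]\<^bsup>2\<^esup> - [T \<inter> U]\<^bsup>2\<^esup>)"
      using T' by (subst card_Diff_subset) (auto simp: finite_imp_finite_nsets intro!: nsets_mono)
    also have "\<dots> \<le> card ([T]\<^bsup>2\<^esup> - E)"
      using T' E by (intro card_mono) (auto simp: finite_imp_finite_nsets nsets_def)
    finally show "(r choose 2) - (card (T \<inter> U) choose 2) \<le> card ([T]\<^bsup>2\<^esup> - E)" .
  qed
  also have "\<dots> = (\<Sum>J\<in>\<J>. \<Sum>T\<in>{T\<in>\<T>. T \<inter> U = J}. p ^ ((r choose 2) - (card (T \<inter> U) choose 2)))"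
    using J by (intro sum.group[symmetric] fin) auto
  also have "\<dots> = (\<Sum>J\<in>\<J>. real (card {T\<in>\<T>. T \<inter> U = J}) * p ^ ((r choose 2) - (card J choose 2)))"
    by (intro sum.cong refl) simp
  also have "\<dots> \<le> (\<Sum>J\<in>\<J>. real (card V) ^ (r - card J) * p ^ ((r choose 2) - (card J choose 2)))"
  proof (intro sum_mono mult_right_mono)
    fix J assume "J \<in> \<J>"
    have "card {T\<in>\<T>. T \<inter> U = J} \<le> card {T\<in>[V]\<^bsup>r\<^esup>. T \<inter> U = J}"
      using T V by (intro card_mono) (auto simp: finite_imp_finite_nsets)
    also have "\<dots> \<le> card V ^ (r - card J)"
      using J \<open>J \<in> \<J>\<close> V by (intro card_nsets_Int_eq_le) auto
    finally show "real (card {T\<in>\<T>. T \<inter> U = J}) \<le> real (card V) ^ (r - card J)"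
      by (metis of_nat_le_iff of_nat_power)
  qed (use p in auto)
  finally show ?thesis .
qed

text \<open>A different 4-set sharing an edge with \<open>T\<close> meets \<open>T\<close> in one of
  6 pairs, leaving five new edges, or in one of 4 triples, leaving three; \<open>small\<close> is
  the resulting dependency sum.\<close>

lemma prob_set_without_K4_le:
  assumes V: "finite V" and p: "0 \<le> p" "p \<le> 1" and S: "S \<subseteq> V"
    and small: "6 * real (card V) ^ 2 * p ^ 5 + 4 * real (card V) * p ^ 3 \<le> 1/2"
  shows "measure_pmf.prob (percolation ([V]\<^bsup>2\<^esup>) p) {R. \<forall>T\<in>[S]\<^bsup>4\<^esup>. \<not> [T]\<^bsup>2\<^esup> \<subseteq> R}
    \<le> (1 - p ^ 6 / 2) ^ (card S choose 4)"
proof -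
  have "measure_pmf.prob (percolation ([V]\<^bsup>2\<^esup>) p) {R. \<forall>T\<in>[S]\<^bsup>4\<^esup>. \<not> [T]\<^bsup>2\<^esup> \<subseteq> R}
     \<le> (1 - p ^ 6 / 2) ^ card ([S]\<^bsup>4\<^esup>)"
  proof (rule prob_percolation_none_le)
    fix T assume T: "T \<in> [S]\<^bsup>4\<^esup>"
    then have T': "finite T" "card T = 4" "T \<subseteq> V"
      using S by (auto simp: nsets_def)
    show "[T]\<^bsup>2\<^esup> \<subseteq> [V]\<^bsup>2\<^esup> \<and> card ([T]\<^bsup>2\<^esup>) = 6"
      using T' by (auto simp: nsets_mono[THEN subsetD] choose_two)
    let ?\<J> = "[T]\<^bsup>2\<^esup> \<union> [T]\<^bsup>3\<^esup>"
    have "(\<Sum>T'\<in>{T' \<in> [S]\<^bsup>4\<^esup>. T' \<noteq> T \<and> [T']\<^bsup>2\<^esup> \<inter> [T]\<^bsup>2\<^esup> \<noteq> {}}. p ^ card ([T']\<^bsup>2\<^esup> - [T]\<^bsup>2\<^esup>))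
      \<le> (\<Sum>J\<in>?\<J>. real (card V) ^ (4 - card J) * p ^ ((4 choose 2) - (card J choose 2)))"
    proof (rule sum_new_edges_le[OF V p subset_refl])
      show "{T' \<in> [S]\<^bsup>4\<^esup>. T' \<noteq> T \<and> [T']\<^bsup>2\<^esup> \<inter> [T]\<^bsup>2\<^esup> \<noteq> {}} \<subseteq> [V]\<^bsup>4\<^esup>"
        using nsets_mono[OF S] by auto
      fix T' assume T': "T' \<in> {T' \<in> [S]\<^bsup>4\<^esup>. T' \<noteq> T \<and> [T']\<^bsup>2\<^esup> \<inter> [T]\<^bsup>2\<^esup> \<noteq> {}}"
      then obtain e where "e \<in> [T']\<^bsup>2\<^esup>" "e \<in> [T]\<^bsup>2\<^esup>"
        by auto
      then have "e \<subseteq> T' \<inter> T" "card e = 2"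
        by (auto simp: nsets_def)
      then have 2: "2 \<le> card (T' \<inter> T)"
        using \<open>finite T\<close> by (metis card_mono finite_Int)
      have "card (T' \<inter> T) < 4"
      proof -
        have "T' \<inter> T \<noteq> T"
          using T T' card_subset_eq[of T' T] by (auto simp: nsets_def)
        then have "T' \<inter> T \<subset> T"
          by auto
        then show ?thesis
          using \<open>finite T\<close> \<open>card T = 4\<close> psubset_card_mono by metis
      qed
      with 2 have "card (T' \<inter> T) = 2 \<or> card (T' \<inter> T) = 3"
        by linarith
      then show "T' \<inter> T \<in> ?\<J>"
        using \<open>finite T\<close> by (auto simp: nsets_def)
    qed (use \<open>finite T\<close> in \<open>auto simp: finite_imp_finite_nsets nsets_def\<close>)
    also have "\<dots> = (\<Sum>J\<in>[T]\<^bsup>2\<^esup>. real (card V) ^ 2 * p ^ 5) + (\<Sum>J\<in>[T]\<^bsup>3\<^esup>. real (card V) * p ^ 3)"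
      using \<open>finite T\<close>
      by (subst sum.union_disjoint)
        (auto simp: finite_imp_finite_nsets nsets_def choose_two intro!: arg_cong2[of _ _ _ _ "(+)"] sum.cong)
    also have "\<dots> = 6 * real (card V) ^ 2 * p ^ 5 + 4 * real (card V) * p ^ 3"
      using T' by (simp add: choose_two eval_nat_numeral)
    finally show "(\<Sum>T'\<in>{T' \<in> [S]\<^bsup>4\<^esup>. T' \<noteq> T \<and> [T']\<^bsup>2\<^esup> \<inter> [T]\<^bsup>2\<^esup> \<noteq> {}}. p ^ card ([T']\<^bsup>2\<^esup> - [T]\<^bsup>2\<^esup>)) \<le> 1/2"
      using small by simp
  qed (use V S p in \<open>auto simp: finite_imp_finite_nsets finite_subset\<close>)
  then show ?thesis
    by simp
qed

text \<open>Union bound over the sets \<open>S\<close>, with \<open>1 - x \<le> exp (- x)\<close>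
  and \<open>(s / 4) ^ 4\<close> as a lower bound for the number of 4-subsets.\<close>

lemma prob_large_set_without_K4_le:
  assumes V: "finite V" and p: "0 \<le> p" "p \<le> 1" and s: "4 \<le> s"
    and small: "6 * real (card V) ^ 2 * p ^ 5 + 4 * real (card V) * p ^ 3 \<le> 1/2"
  shows "measure_pmf.prob (percolation ([V]\<^bsup>2\<^esup>) p)
      {R. \<exists>S\<subseteq>V. s \<le> real (card S) \<and> (\<forall>T\<in>[S]\<^bsup>4\<^esup>. \<not> [T]\<^bsup>2\<^esup> \<subseteq> R)}
    \<le> 2 ^ card V * exp (- (p ^ 6 / 2 * (s / 4) ^ 4))"
proof -
  let ?I = "{S. S \<subseteq> V \<and> s \<le> real (card S)}"
  have I: "finite ?I"
    using V by simp
  have "measure_pmf.prob (percolation ([V]\<^bsup>2\<^esup>) p)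
      {R. \<exists>S\<subseteq>V. s \<le> real (card S) \<and> (\<forall>T\<in>[S]\<^bsup>4\<^esup>. \<not> [T]\<^bsup>2\<^esup> \<subseteq> R)}
    \<le> (\<Sum>S\<in>?I. measure_pmf.prob (percolation ([V]\<^bsup>2\<^esup>) p) {R. \<forall>T\<in>[S]\<^bsup>4\<^esup>. \<not> [T]\<^bsup>2\<^esup> \<subseteq> R})"
    using I V by (intro prob_percolation_union_bound) (auto simp: finite_imp_finite_nsets)
  also have "\<dots> \<le> (\<Sum>S\<in>?I. exp (- (p ^ 6 / 2 * (s / 4) ^ 4)))"
  proof (rule sum_mono)
    fix S assume S: "S \<in> ?I"
    then have "4 \<le> card S"
      using s by auto
    have "(s / 4) ^ 4 \<le> (real (card S) / 4) ^ 4"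
      using S s by (intro power_mono) auto
    also have "\<dots> \<le> real (card S choose 4)"
      using binomial_ge_n_over_k_pow_k[OF \<open>4 \<le> card S\<close>, where 'a = real] by simp
    finally have "p ^ 6 / 2 * (s / 4) ^ 4 \<le> p ^ 6 / 2 * real (card S choose 4)"
      using p by (intro mult_left_mono) auto
    have "measure_pmf.prob (percolation ([V]\<^bsup>2\<^esup>) p) {R. \<forall>T\<in>[S]\<^bsup>4\<^esup>. \<not> [T]\<^bsup>2\<^esup> \<subseteq> R}
        \<le> (1 - p ^ 6 / 2) ^ (card S choose 4)"
      using S by (intro prob_set_without_K4_le V p small) auto
    also have "\<dots> \<le> exp (- (p ^ 6 / 2)) ^ (card S choose 4)"
      using exp_ge_add_one_self[of "- (p ^ 6 / 2)"] p power_le_one[of p 6]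
      by (intro power_mono) auto
    also have "\<dots> = exp (- (p ^ 6 / 2 * real (card S choose 4)))"
      by (simp add: exp_of_nat_mult[symmetric] mult.commute)
    also have "\<dots> \<le> exp (- (p ^ 6 / 2 * (s / 4) ^ 4))"
      using \<open>_ \<le> p ^ 6 / 2 * real (card S choose 4)\<close> by simp
    finally show "measure_pmf.prob (percolation ([V]\<^bsup>2\<^esup>) p) {R. \<forall>T\<in>[S]\<^bsup>4\<^esup>. \<not> [T]\<^bsup>2\<^esup> \<subseteq> R}
        \<le> exp (- (p ^ 6 / 2 * (s / 4) ^ 4))" .
  qed
  also have "\<dots> = real (card ?I) * exp (- (p ^ 6 / 2 * (s / 4) ^ 4))"
    by simp
  also have "\<dots> \<le> 2 ^ card V * exp (- (p ^ 6 / 2 * (s / 4) ^ 4))"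
  proof (rule mult_right_mono)
    have "card ?I \<le> card (Pow V)"
      using V by (intro card_mono) auto
    then show "real (card ?I) \<le> 2 ^ card V"
      using V by (simp add: card_Pow)
  qed simp
  finally show ?thesis .
qed

text \<open>For \<open>p = n^(-1/2 + e)\<close> and \<open>s = n^(1 - e)\<close> the exponent
  \<open>p^6 s^4\<close> has order \<open>n^(1 + 2e)\<close> and beats the factor
  \<open>2^n\<close>. The dependency sum has order \<open>n^(-1/2 + 5e)\<close>, which vanishes
  since \<open>e < 1/12\<close>.\<close>

lemma aas_K4_in_large_sets:
  fixes e :: real
  assumes e: "0 < e" "e < 1/12"
  shows "(\<lambda>n. measure_pmf.prob (percolation ([{..<n}]\<^bsup>2\<^esup>) (real n powr (- 1/2 + e)))
      {R. \<exists>S\<subseteq>{..<n}. real n powr (1 - e) \<le> real (card S) \<and> (\<forall>T\<in>[S]\<^bsup>4\<^esup>. \<not> [T]\<^bsup>2\<^esup> \<subseteq> R)})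
    \<longlonglongrightarrow> 0"
proof (rule tendsto_sandwich[OF _ _ tendsto_const])
  let ?p = "\<lambda>n::nat. real n powr (- 1/2 + e)"
  have "(\<lambda>n. 6 * real n ^ 2 * ?p n ^ 5 + 4 * real n * ?p n ^ 3) \<longlonglongrightarrow> 0"
    using e by real_asymp
  then have "\<forall>\<^sub>F n in sequentially. 6 * real n ^ 2 * ?p n ^ 5 + 4 * real n * ?p n ^ 3 < 1/2"
    by (rule order_tendstoD) simp
  moreover have "\<forall>\<^sub>F n in sequentially. real n powr (1 - e) \<ge> 4"
    using e by real_asymp
  moreover have "\<forall>\<^sub>F n in sequentially. ?p n \<le> 1"
    using e by real_asymp
  ultimately show "\<forall>\<^sub>F n in sequentially. measure_pmf.prob (percolation ([{..<n}]\<^bsup>2\<^esup>) (?p n))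
      {R. \<exists>S\<subseteq>{..<n}. real n powr (1 - e) \<le> real (card S) \<and> (\<forall>T\<in>[S]\<^bsup>4\<^esup>. \<not> [T]\<^bsup>2\<^esup> \<subseteq> R)}
    \<le> 2 ^ n * exp (- (?p n ^ 6 / 2 * (real n powr (1 - e) / 4) ^ 4))"
  proof eventually_elim
    case (elim n)
    then show ?case
      using prob_large_set_without_K4_le[of "{..<n}" "?p n" "real n powr (1 - e)"] by simp
  qed
  show "(\<lambda>n. 2 ^ n * exp (- (?p n ^ 6 / 2 * (real n powr (1 - e) / 4) ^ 4))) \<longlonglongrightarrow> 0"
    using e by real_asymp
qed simp

subsection \<open>Dense graphs\<close>

lemma clique_iff_nsets: "clique S E \<longleftrightarrow> [S]\<^bsup>2\<^esup> \<subseteq> E"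
  by (auto simp: clique_def nsets_2_eq)

section \<open>Double counting and dependent random choice\<close>

lemma sum_card_neighbours:
  assumes "finite V" "E \<subseteq> [V]\<^bsup>2\<^esup>"
  shows "(\<Sum>a\<in>V. card {b \<in> V. {a, b} \<in> E}) = 2 * card E"
proof -
  have fin: "finite E"
    using assms finite_subset finite_imp_finite_nsets by blast
  have "(\<Sum>a\<in>V. card {b \<in> V. {a, b} \<in> E}) = (\<Sum>a\<in>V. card {e \<in> E. a \<in> e})"
  proof (rule sum.cong[OF refl])
    fix a assume "a \<in> V"
    have "bij_betw (\<lambda>b. {a, b}) {b \<in> V. {a, b} \<in> E} {e \<in> E. a \<in> e}"
      unfolding bij_betw_def
    proof
      show "inj_on (\<lambda>b. {a, b}) {b \<in> V. {a, b} \<in> E}"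
        by (auto simp: inj_on_def doubleton_eq_iff)
      show "(\<lambda>b. {a, b}) ` {b \<in> V. {a, b} \<in> E} = {e \<in> E. a \<in> e}"
      proof (intro equalityI subsetI)
        fix e assume e: "e \<in> {e \<in> E. a \<in> e}"
        then have "e \<in> [V]\<^bsup>2\<^esup>"
          using assms by auto
        with e obtain b where "e = {a, b}" "b \<in> V"
          by (auto simp: nsets_2_eq)
        with e show "e \<in> (\<lambda>b. {a, b}) ` {b \<in> V. {a, b} \<in> E}"
          by auto
      qed auto
    qed
    then show "card {b \<in> V. {a, b} \<in> E} = card {e \<in> E. a \<in> e}"
      by (rule bij_betw_same_card)
  qed
  also have "\<dots> = (\<Sum>e\<in>E. 2)"
  proof (rule sum_multicount_gen[OF assms(1) fin], rule ballI)
    fix e assume "e \<in> E"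
    then have "e \<subseteq> V" "card e = 2"
      using assms by (auto simp: nsets_def)
    then show "card {i \<in> V. i \<in> e} = 2"
      by (metis Collect_conj_eq Collect_mem_eq inf.absorb_iff2)
  qed
  finally show ?thesis
    by simp
qed

text \<open>Alteration: one vertex of every pair in \<open>B\<close> is deleted.\<close>

lemma exists_subset_avoiding_pairs:
  assumes "finite X" "B \<subseteq> [X]\<^bsup>2\<^esup>"
  obtains U where "U \<subseteq> X" "card X \<le> card U + card B" "\<And>e. e \<in> B \<Longrightarrow> \<not> e \<subseteq> U"
proof
  let ?f = "\<lambda>e. SOME x. x \<in> e"
  let ?U = "X - ?f ` B"
  have fin: "finite B"
    using assms finite_subset finite_imp_finite_nsets by blast
  show "card X \<le> card ?U + card B"
    using diff_card_le_card_Diff[of "?f ` B" X] card_image_le[OF fin, of ?f] fin by simp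
  fix e assume "e \<in> B"
  then have "e \<noteq> {}"
    using assms(2) by (auto simp: nsets_def)
  then have "?f e \<in> e"
    by (simp add: some_in_eq)
  with \<open>e \<in> B\<close> show "\<not> e \<subseteq> ?U"
    by blast
qed blast

text \<open>Averaging over all lists \<open>xs\<close> of \<open>t\<close> vertices, repetitions
  allowed. A vertex of large degree is a common neighbour of many lists, while a pair with fewer
  than \<open>s\<close> common neighbours survives for at most \<open>s ^ t\<close> lists. So for
  some list the common neighbourhood \<open>X xs\<close> exceeds the number of bad pairs
  \<open>Y xs\<close> by the required amount, and one vertex of each bad pair is deleted.\<close>

lemma dependent_random_choice:
  fixes \<gamma> s :: real and t :: nat
  assumes V: "finite V" "V \<noteq> {}" and E: "E \<subseteq> [V]\<^bsup>2\<^esup>"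
    and \<gamma>: "0 < \<gamma>" "\<gamma> * (real (card V))\<^sup>2 \<le> real (card E)" and s: "0 \<le> s"
  obtains U where "U \<subseteq> V"
    "\<gamma> ^ Suc t * real (card V) - (real (card V))\<^sup>2 * (s / real (card V)) ^ t \<le> real (card U)"
    "\<And>a b. a \<in> U \<Longrightarrow> b \<in> U \<Longrightarrow> a \<noteq> b \<Longrightarrow> s \<le> real (card {x \<in> V. {a, x} \<in> E \<and> {b, x} \<in> E})"
proof -
  define n where "n = card V"
  have n: "n > 0"
    using V by (auto simp: n_def card_gt_0_iff)
  \<comment> \<open>Common neighbourhood of the vertices in \<open>e\<close>; applied to singletons
    and to pairs.\<close>
  let ?N = "\<lambda>e. {x \<in> V. \<forall>a\<in>e. {a, x} \<in> E}"
  define L where "L = {xs. set xs \<subseteq> V \<and> length xs = t}"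
  have L: "finite L" "card L = n ^ t"
    using V by (auto simp: L_def n_def card_lists_length_eq finite_lists_length_eq)
  have cL: "card {xs \<in> L. set xs \<subseteq> A} = card A ^ t" if "A \<subseteq> V" for A
  proof -
    have "{xs \<in> L. set xs \<subseteq> A} = {xs. set xs \<subseteq> A \<and> length xs = t}"
      using that by (auto simp: L_def)
    then show ?thesis
      using that V finite_subset by (metis card_lists_length_eq)
  qed
  define X where "X = (\<lambda>xs. {a \<in> V. set xs \<subseteq> ?N {a}})"
  define B where "B = {e \<in> [V]\<^bsup>2\<^esup>. real (card (?N e)) < s}"
  define Y where "Y = (\<lambda>xs. {e \<in> B. set xs \<subseteq> ?N e})"
  have B: "finite B" "B \<subseteq> [V]\<^bsup>2\<^esup>"
    using V by (auto simp: B_def finite_imp_finite_nsets)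
  have "(\<Sum>xs\<in>L. card (X xs)) = (\<Sum>a\<in>V. card (?N {a}) ^ t)"
    unfolding X_def by (rule sum_multicount_gen[OF L(1) V(1)]) (auto intro!: cL)
  then have sX: "(\<Sum>xs\<in>L. real (card (X xs))) = (\<Sum>a\<in>V. real (card (?N {a})) ^ t)"
    by (simp flip: of_nat_sum of_nat_power)
  have "(\<Sum>xs\<in>L. card (Y xs)) = (\<Sum>e\<in>B. card (?N e) ^ t)"
    unfolding Y_def by (rule sum_multicount_gen[OF L(1) B(1)]) (auto intro!: cL)
  then have sY: "(\<Sum>xs\<in>L. real (card (Y xs))) = (\<Sum>e\<in>B. real (card (?N e)) ^ t)"
    by (simp flip: of_nat_sum of_nat_power)
  have "(\<Sum>e\<in>B. real (card (?N e)) ^ t) \<le> (\<Sum>e\<in>B. s ^ t)"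
    by (intro sum_mono power_mono) (auto simp: B_def)
  also have "\<dots> = real (card B) * s ^ t"
    by simp
  also have "\<dots> \<le> (real n)\<^sup>2 * s ^ t"
  proof (intro mult_right_mono)
    have "card B \<le> card ([V]\<^bsup>2\<^esup>)"
      using B V by (intro card_mono) (auto simp: finite_imp_finite_nsets)
    also have "\<dots> \<le> n ^ 2"
      by (simp add: n_def binomial_le_power)
    finally show "real (card B) \<le> (real n)\<^sup>2"
      by (metis of_nat_le_iff of_nat_power)
  qed (use s in auto)
  finally have Y: "(\<Sum>xs\<in>L. real (card (Y xs))) \<le> (real n)\<^sup>2 * s ^ t"
    by (simp add: sY)
  \<comment> \<open>Restricting to vertices of large degree replaces a convexity argument; the size
    of \<open>H\<close> supplies the additional factor in \<open>\<gamma> ^ Suc t\<close>.\<close>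
  define H where "H = {a \<in> V. \<gamma> * n \<le> real (card (?N {a}))}"
  have H: "H \<subseteq> V" "finite H"
    using V by (auto simp: H_def)
  \<comment> \<open>The degrees sum to at least \<open>2 * \<gamma> * n^2\<close> and vertices
    outside \<open>H\<close> contribute at most half of this, so \<open>H\<close> carries the other
    half.\<close>
  have "2 * \<gamma> * (real n)\<^sup>2 \<le> 2 * real (card E)"
    using \<gamma> by (simp add: n_def)
  also have "\<dots> = (\<Sum>a\<in>V. real (card (?N {a})))"
    using sum_card_neighbours[OF V(1) E] by (simp flip: of_nat_sum)
  also have "\<dots> = (\<Sum>a\<in>H. real (card (?N {a}))) + (\<Sum>a\<in>V-H. real (card (?N {a})))"
    using H V by (metis (no_types, lifting) sum.subset_diff add.commute)
  also have "\<dots> \<le> (\<Sum>a\<in>H. real n) + (\<Sum>a\<in>V-H. \<gamma> * real n)"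
    using V by (intro add_mono sum_mono) (auto simp: H_def n_def intro!: card_mono)
  also have "\<dots> \<le> real (card H) * real n + real n * (\<gamma> * real n)"
    using \<gamma> V by (auto simp: n_def intro!: mult_right_mono card_mono)
  finally have "\<gamma> * real n * real n \<le> real (card H) * real n"
    by (simp add: power2_eq_square algebra_simps)
  then have cH: "\<gamma> * real n \<le> real (card H)"
    using n by simp
  have "\<gamma> * real n * (\<gamma> * real n) ^ t \<le> real (card H) * (\<gamma> * real n) ^ t"
    using cH \<gamma> by (intro mult_right_mono) auto
  also have "\<dots> = (\<Sum>a\<in>H. (\<gamma> * real n) ^ t)"
    by simp
  also have "\<dots> \<le> (\<Sum>a\<in>H. real (card (?N {a})) ^ t)"
    using \<gamma> by (intro sum_mono power_mono) (auto simp: H_def)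
  also have "\<dots> \<le> (\<Sum>a\<in>V. real (card (?N {a})) ^ t)"
    using H V by (intro sum_mono2) auto
  finally have X: "\<gamma> * real n * (\<gamma> * real n) ^ t \<le> (\<Sum>xs\<in>L. real (card (X xs)))"
    by (simp add: sX)
  let ?c = "\<gamma> ^ Suc t * real n - (real n)\<^sup>2 * (s / real n) ^ t"
  have "\<exists>xs\<in>L. ?c \<le> real (card (X xs)) - real (card (Y xs))"
  proof (rule ccontr)
    assume "\<not> ?thesis"
    then have *: "real (card (X xs)) - real (card (Y xs)) < ?c" if "xs \<in> L" for xs
      using that by auto
    have "L \<noteq> {}"
      using L n by auto
    then have "(\<Sum>xs\<in>L. real (card (X xs)) - real (card (Y xs))) < (\<Sum>xs\<in>L. ?c)"
      using L * by (intro sum_strict_mono) auto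
    also have "\<dots> = real n ^ t * ?c"
      using L by simp
    also have "\<dots> = \<gamma> * real n * (\<gamma> * real n) ^ t - (real n)\<^sup>2 * s ^ t"
      using n by (simp add: algebra_simps power_divide power_mult_distrib)
    finally show False
      using X Y by (simp add: sum_subtractf)
  qed
  then obtain xs where xs: "xs \<in> L" "?c \<le> real (card (X xs)) - real (card (Y xs))"
    by auto
  have "finite (X xs)" "X xs \<subseteq> V"
    using V by (auto simp: X_def)
  let ?B = "B \<inter> [X xs]\<^bsup>2\<^esup>"
  have "?B \<subseteq> Y xs"
    using xs(1) by (auto simp: Y_def X_def nsets_def L_def)
  then have cB: "card ?B \<le> card (Y xs)"
    using B by (intro card_mono) (auto simp: Y_def)
  obtain U where U: "U \<subseteq> X xs" "card (X xs) \<le> card U + card ?B" "\<And>e. e \<in> ?B \<Longrightarrow> \<not> e \<subseteq> U"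
    using exists_subset_avoiding_pairs[OF \<open>finite (X xs)\<close>, of ?B] by auto
  show ?thesis
  proof (rule that[of U])
    show "U \<subseteq> V"
      using U \<open>X xs \<subseteq> V\<close> by auto
    show "\<gamma> ^ Suc t * real (card V) - (real (card V))\<^sup>2 * (s / real (card V)) ^ t \<le> real (card U)"
      using U(2) cB xs(2) unfolding n_def by linarith
    fix a b assume ab: "a \<in> U" "b \<in> U" "a \<noteq> b"
    then have "{a, b} \<in> [X xs]\<^bsup>2\<^esup>" "{a, b} \<in> [V]\<^bsup>2\<^esup>"
      using U \<open>X xs \<subseteq> V\<close> by auto
    moreover have "{a, b} \<notin> ?B"
      using ab U(3)[of "{a, b}"] by blast
    ultimately have "{a, b} \<notin> B"
      by auto
    with \<open>{a, b} \<in> [V]\<^bsup>2\<^esup>\<close> have "s \<le> real (card (?N {a, b}))"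
      by (auto simp: B_def)
    then show "s \<le> real (card {x \<in> V. {a, x} \<in> E \<and> {b, x} \<in> E})"
      by simp
  qed
qed

text \<open>
  If some edge \<open>ab\<close> of \<open>R\<close> inside \<open>U\<close> has colour \<open>i\<close>, then the common neighbourhood of \<open>a\<close> and \<open>b\<close> in
  colour \<open>i\<close> contains a \<open>K\<^sub>4\<close> of \<open>R\<close>, and an edge of colour \<open>i\<close> in it completes \<open>ab\<close>.
\<close>
lemma mono_K4_of_codegree:
  fixes c :: "'a set \<Rightarrow> bool" and s :: real
  assumes G: "G \<subseteq> [V]\<^bsup>2\<^esup>"
    and K4: "\<And>S. S \<subseteq> V \<Longrightarrow> s \<le> real (card S) \<Longrightarrow> \<exists>T\<in>[S]\<^bsup>4\<^esup>. [T]\<^bsup>2\<^esup> \<subseteq> R"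
    and U: "U \<subseteq> V" "s \<le> real (card U)"
    and codeg: "\<And>a b. a \<in> U \<Longrightarrow> b \<in> U \<Longrightarrow> a \<noteq> b \<Longrightarrow>
      s \<le> real (card {x \<in> V. {a, x} \<in> {e \<in> G. c e = i} \<and> {b, x} \<in> {e \<in> G. c e = i}})"
  shows "\<exists>j. has_complete_subgraph V {e \<in> G \<union> R. c e = j} 4"
proof -
  have mono: "\<exists>j. has_complete_subgraph V {e \<in> G \<union> R. c e = j} 4"
    if T: "T \<in> [V]\<^bsup>4\<^esup>" "[T]\<^bsup>2\<^esup> \<subseteq> R" and "\<forall>e\<in>[T]\<^bsup>2\<^esup>. c e \<noteq> i" for T
  proof -
    have "[T]\<^bsup>2\<^esup> \<subseteq> {e \<in> G \<union> R. c e = (\<not> i)}"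
      using that by auto
    then show ?thesis
      using T unfolding has_complete_subgraph_def clique_iff_nsets by blast
  qed
  obtain T where T: "T \<in> [U]\<^bsup>4\<^esup>" "[T]\<^bsup>2\<^esup> \<subseteq> R"
    using K4[OF U] by blast
  show ?thesis
  proof (cases "\<forall>e\<in>[T]\<^bsup>2\<^esup>. c e \<noteq> i")
    case True
    then show ?thesis
      using T U nsets_mono by (intro mono[of T]) blast+
  next
    case False
    then obtain a b where ab: "a \<in> T" "b \<in> T" "a \<noteq> b" "c {a, b} = i"
      by (auto simp: nsets_2_eq)
    then have abU: "a \<in> U" "b \<in> U" "{a, b} \<in> R"
      using T by (auto simp: nsets_def)
    let ?Q = "{x \<in> V. {a, x} \<in> {e \<in> G. c e = i} \<and> {b, x} \<in> {e \<in> G. c e = i}}"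
    obtain T' where T': "T' \<in> [?Q]\<^bsup>4\<^esup>" "[T']\<^bsup>2\<^esup> \<subseteq> R"
      using K4[of ?Q] codeg[OF abU(1,2) ab(3)] by blast
    show ?thesis
    proof (cases "\<forall>e\<in>[T']\<^bsup>2\<^esup>. c e \<noteq> i")
      case True
      have "T' \<in> [V]\<^bsup>4\<^esup>"
        using T'(1) by (auto simp: nsets_def)
      then show ?thesis
        using T' True by (intro mono[of T'])
    next
      case False
      then obtain x y where xy: "x \<in> T'" "y \<in> T'" "x \<noteq> y" "c {x, y} = i"
        by (auto simp: nsets_2_eq)
      then have xyQ: "x \<in> ?Q" "y \<in> ?Q" "{x, y} \<in> R"
        using T' by (auto simp: nsets_def)
      \<comment> \<open>Edges of \<open>G\<close> have two distinct ends, which makes the four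
        vertices distinct.\<close>
      have "{a, x} \<in> [V]\<^bsup>2\<^esup>" "{b, x} \<in> [V]\<^bsup>2\<^esup>" "{a, y} \<in> [V]\<^bsup>2\<^esup>" "{b, y} \<in> [V]\<^bsup>2\<^esup>"
        using xyQ subsetD[OF G] by blast+
      then have "a \<in> V" "b \<in> V" "x \<in> V" "y \<in> V" "a \<noteq> x" "b \<noteq> x" "a \<noteq> y" "b \<noteq> y"
        by simp_all
      then have "{a, b, x, y} \<in> [V]\<^bsup>4\<^esup>"
        using ab(3) xy(3) by (simp add: nsets_def)
      moreover have "clique {a, b, x, y} {e \<in> G \<union> R. c e = i}"
        using ab xy abU xyQ unfolding clique_def by (auto simp: insert_commute)
      ultimately show ?thesis
        unfolding has_complete_subgraph_def by blast
    qed
  qed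
qed

text \<open>One colour class keeps half of the edges of \<open>G\<close>, hence the density
  \<open>\<gamma> / 2\<close>. The hypothesis \<open>large\<close> says that dependent random choice
  leaves at least \<open>s\<close> vertices, so \<open>K4\<close> applies to \<open>U\<close> as
  well as to common neighbourhoods.\<close>

lemma dense_ramsey_arrow_K4:
  fixes \<gamma> s :: real
  assumes V: "finite V" "V \<noteq> {}" and G: "G \<subseteq> [V]\<^bsup>2\<^esup>"
    and \<gamma>: "0 < \<gamma>" "\<gamma> * (real (card V))\<^sup>2 \<le> real (card G)" and s: "0 \<le> s"
    and K4: "\<And>S. S \<subseteq> V \<Longrightarrow> s \<le> real (card S) \<Longrightarrow> \<exists>T\<in>[S]\<^bsup>4\<^esup>. [T]\<^bsup>2\<^esup> \<subseteq> R"
    and large: "s \<le> (\<gamma> / 2) ^ Suc t * real (card V) - (real (card V))\<^sup>2 * (s / real (card V)) ^ t"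
  shows "ramsey_arrow V (G \<union> R) 4"
  unfolding ramsey_arrow_def
proof
  fix c :: "'a set \<Rightarrow> bool"
  have "G = {e \<in> G. c e = True} \<union> {e \<in> G. c e = False}"
    by auto
  then have "card G \<le> card {e \<in> G. c e = True} + card {e \<in> G. c e = False}"
    by (metis card_Un_le)
  then have "real (card G) / 2 \<le> real (card {e \<in> G. c e = True}) \<or> real (card G) / 2 \<le> real (card {e \<in> G. c e = False})"
    by linarith
  then obtain i where i: "real (card G) / 2 \<le> real (card {e \<in> G. c e = i})"
    by blast
  then have *: "\<gamma> / 2 * (real (card V))\<^sup>2 \<le> real (card {e \<in> G. c e = i})"
    using \<gamma> by linarith
  obtain U where U: "U \<subseteq> V"
    "(\<gamma> / 2) ^ Suc t * real (card V) - (real (card V))\<^sup>2 * (s / real (card V)) ^ t \<le> real (card U)"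
    "\<And>a b. a \<in> U \<Longrightarrow> b \<in> U \<Longrightarrow> a \<noteq> b \<Longrightarrow>
      s \<le> real (card {x \<in> V. {a, x} \<in> {e \<in> G. c e = i} \<and> {b, x} \<in> {e \<in> G. c e = i}})"
  proof (rule dependent_random_choice[OF V _ _ * s, of t])
    show "{e \<in> G. c e = i} \<subseteq> [V]\<^bsup>2\<^esup>"
      using G by auto
    show "0 < \<gamma> / 2"
      using \<gamma> by simp
  qed blast
  show "\<exists>j. has_complete_subgraph V {e \<in> G \<union> R. c e = j} 4"
    using U(2) large by (intro mono_K4_of_codegree[OF G K4 U(1) _ U(3)]) auto
qed

text \<open>The random event, a clique of \<open>R\<close> in every large set, does not mention
  \<open>G\<close>; this gives uniformity over all \<open>G\<close>. It is increasing in
  \<open>R\<close>, so it suffices to treat the density \<open>n^(-1/2 + e)\<close> for a small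
  \<open>e\<close>.\<close>

lemma prob_dense_arrow:
  fixes \<gamma> \<epsilon> \<delta> :: real and p :: "nat \<Rightarrow> real"
  assumes \<gamma>: "0 < \<gamma>" and \<epsilon>: "0 < \<epsilon>" and p: "\<And>n. 0 \<le> p n \<and> p n \<le> 1"
    and p_ge: "\<forall>\<^sub>F n in sequentially. p n \<ge> real n powr (- 1 / 2 + \<epsilon>)" and \<delta>: "0 < \<delta>"
  shows "\<forall>\<^sub>F n in sequentially. \<forall>G. simple_graph {..<n} G \<and> real (card G) \<ge> \<gamma> * (real n)\<^sup>2 \<longrightarrow>
     measure_pmf.prob (binomial_random_graph {..<n} (p n)) {R. ramsey_arrow {..<n} (G \<union> R) 4} > 1 - \<delta>"
proof -
  define e where "e = min \<epsilon> (1/20)"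
  have e: "0 < e" "e < 1/12" "e \<le> \<epsilon>"
    using \<epsilon> by (auto simp: e_def)
  \<comment> \<open>With \<open>e * t \<ge> 2\<close> the error term
    \<open>n^2 * (n^(- e))^t\<close> of dependent random choice is at most 1, which is the
    \<open>- 1\<close> subtracted from \<open>\<kappa> * real n\<close> below.\<close>
  obtain t :: nat where t: "2 / e \<le> real t"
    using real_arch_simple by blast
  then have et: "2 \<le> e * real t"
    using e by (simp add: field_simps)
  define \<kappa> where "\<kappa> = (\<gamma> / 2) ^ Suc t"
  have \<kappa>: "\<kappa> > 0"
    using \<gamma> by (simp add: \<kappa>_def)
  let ?q = "\<lambda>n::nat. real n powr (- 1/2 + e)"
  let ?Z = "\<lambda>n R. \<exists>S\<subseteq>{..<n}. real n powr (1 - e) \<le> real (card S) \<and> (\<forall>T\<in>[S]\<^bsup>4\<^esup>. \<not> [T]\<^bsup>2\<^esup> \<subseteq> R)"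
  have "\<forall>\<^sub>F n in sequentially. measure_pmf.prob (percolation ([{..<n}]\<^bsup>2\<^esup>) (?q n)) {R. ?Z n R} < \<delta>"
    using order_tendstoD(2)[OF aas_K4_in_large_sets[OF e(1,2)] \<delta>] .
  moreover have "\<forall>\<^sub>F n in sequentially. real n powr (1 - e) \<le> \<kappa> * real n - 1"
    using e \<kappa> by real_asymp
  ultimately show ?thesis
    using p_ge eventually_gt_at_top[of 0]
  proof eventually_elim
    case (elim n)
    show ?case
    proof (intro allI impI, elim conjE)
      fix G assume G: "simple_graph {..<n} G" "\<gamma> * (real n)\<^sup>2 \<le> real (card G)"
      have "?q n \<le> real n powr (- 1 / 2 + \<epsilon>)"
        using elim e by (intro powr_mono) auto
      then have qp: "?q n \<le> p n"
        using elim by linarith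
      have "real n powr (1 - e) / real n = real n powr (- e)"
        using elim powr_diff[of "real n" "1 - e" 1] by simp
      then have "(real n powr (1 - e) / real n) ^ t = real n powr (- (e * real t))"
        using elim by (simp add: powr_power mult.commute)
      also have "\<dots> \<le> real n powr (- 2)"
        using elim et by (intro powr_mono) auto
      finally have "(real n)\<^sup>2 * (real n powr (1 - e) / real n) ^ t \<le> (real n)\<^sup>2 * real n powr (- 2)"
        by (rule mult_left_mono) simp
      also have "\<dots> = 1"
        using elim by (simp add: powr_minus)
      finally have large: "real n powr (1 - e) \<le> (\<gamma> / 2) ^ Suc t * real n - (real n)\<^sup>2 * (real n powr (1 - e) / real n) ^ t"
        using elim unfolding \<kappa>_def by linarith
      have arrow: "ramsey_arrow {..<n} (G \<union> R) 4" if "\<not> ?Z n R" for R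
      proof (rule dense_ramsey_arrow_K4[where s = "real n powr (1 - e)" and t = t and \<gamma> = \<gamma>])
        fix S assume "S \<subseteq> {..<n}" "real n powr (1 - e) \<le> real (card S)"
        then show "\<exists>T\<in>[S]\<^bsup>4\<^esup>. [T]\<^bsup>2\<^esup> \<subseteq> R"
          using that by blast
      qed (use G \<gamma> elim large in \<open>auto simp: simple_graph_def\<close>)
      have "1 - \<delta> < 1 - measure_pmf.prob (percolation ([{..<n}]\<^bsup>2\<^esup>) (?q n)) {R. ?Z n R}"
        using elim by simp
      also have "\<dots> = measure_pmf.prob (percolation ([{..<n}]\<^bsup>2\<^esup>) (?q n)) {R. \<not> ?Z n R}"
        by (subst measure_pmf.prob_compl[symmetric]) (auto intro!: arg_cong2[of _ _ _ _ measure])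
      also have "\<dots> \<le> measure_pmf.prob (percolation ([{..<n}]\<^bsup>2\<^esup>) (p n)) {R. \<not> ?Z n R}"
        using qp p by (intro prob_percolation_mono_p) (auto simp: finite_imp_finite_nsets, blast)
      also have "\<dots> \<le> measure_pmf.prob (percolation ([{..<n}]\<^bsup>2\<^esup>) (p n)) {R. ramsey_arrow {..<n} (G \<union> R) 4}"
        using arrow by (intro prob_percolation_mono) (auto simp: finite_imp_finite_nsets)
      finally show "1 - \<delta> < measure_pmf.prob (binomial_random_graph {..<n} (p n)) {R. ramsey_arrow {..<n} (G \<union> R) 4}"
        by (simp add: binomial_random_graph_percolation)
    qed
  qed
qed

subsection \<open>Colourings from small components\<close>

lemma card_Union_nsets_le:
  assumes "X \<subseteq> [V]\<^bsup>q\<^esup>"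
  shows "card (\<Union>X) \<le> q * card X"
proof -
  have "card (\<Union>X) \<le> (\<Sum>e\<in>X. card e)"
    by (rule card_Union_le_sum_card)
  also have "\<dots> = q * card X"
    using assms by (simp add: nsets_def subset_eq)
  finally show ?thesis .
qed

text \<open>Greedy colouring: remove a vertex with at most four neighbours, colour the rest, and
  give it a colour that its neighbours leave free.\<close>

lemma five_colouring_of_degenerate:
  assumes "finite S"
    and "\<And>S'. S' \<subseteq> S \<Longrightarrow> S' \<noteq> {} \<Longrightarrow> \<exists>v\<in>S'. card {w \<in> S'. w \<noteq> v \<and> {v, w} \<in> R} \<le> 4"
  shows "\<exists>\<phi> :: 'a \<Rightarrow> nat. (\<forall>v\<in>S. \<phi> v < 5) \<and> (\<forall>u\<in>S. \<forall>v\<in>S. u \<noteq> v \<and> {u, v} \<in> R \<longrightarrow> \<phi> u \<noteq> \<phi> v)"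
  using assms
proof (induction "card S" arbitrary: S)
  case 0
  then show ?case by auto
next
  case (Suc k)
  then have "S \<noteq> {}"
    by auto
  then obtain v where v: "v \<in> S" "card {w \<in> S. w \<noteq> v \<and> {v, w} \<in> R} \<le> 4"
    using Suc.prems(2)[of S] by blast
  let ?N = "{w \<in> S. w \<noteq> v \<and> {v, w} \<in> R}"
  have "\<exists>\<phi> :: 'a \<Rightarrow> nat. (\<forall>u\<in>S - {v}. \<phi> u < 5)
      \<and> (\<forall>u\<in>S - {v}. \<forall>w\<in>S - {v}. u \<noteq> w \<and> {u, w} \<in> R \<longrightarrow> \<phi> u \<noteq> \<phi> w)"
  proof (rule Suc.hyps(1))
    show "k = card (S - {v})"
      using Suc.hyps(2) Suc.prems(1) v(1) by simp
    show "finite (S - {v})"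
      using Suc.prems(1) by simp
    fix S' assume "S' \<subseteq> S - {v}" "S' \<noteq> {}"
    then show "\<exists>v\<in>S'. card {w \<in> S'. w \<noteq> v \<and> {v, w} \<in> R} \<le> 4"
      by (intro Suc.prems(2)) auto
  qed
  then obtain \<phi> :: "'a \<Rightarrow> nat" where \<phi>: "\<forall>u\<in>S - {v}. \<phi> u < 5"
    "\<forall>u\<in>S - {v}. \<forall>w\<in>S - {v}. u \<noteq> w \<and> {u, w} \<in> R \<longrightarrow> \<phi> u \<noteq> \<phi> w"
    by (elim exE conjE)
  have "card (\<phi> ` ?N) \<le> 4"
    using v(2) card_image_le[of ?N \<phi>] Suc.prems(1) by simp
  moreover have "finite (\<phi> ` ?N)"
    using Suc.prems(1) by simp
  ultimately have "\<not> {..<5} \<subseteq> \<phi> ` ?N"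
    using card_mono[of "\<phi> ` ?N" "{..<5}"] by auto
  then obtain x where x: "x < 5" "x \<notin> \<phi> ` ?N"
    by auto
  have "\<forall>u\<in>S. (\<phi>(v := x)) u < 5"
    using \<phi>(1) x(1) by simp
  moreover have "(\<phi>(v := x)) u \<noteq> (\<phi>(v := x)) w"
    if "u \<in> S" "w \<in> S" "u \<noteq> w" "{u, w} \<in> R" for u w
    using that x(2) \<phi>(2) by (auto simp: insert_commute)
  ultimately show ?case
    by blast
qed

text \<open>
  The blocks are the copies of \<open>K\<^sub>r\<close> in \<open>R\<close>, and two blocks are linked when they share a \<open>q\<close>-set. Only
  \<open>(r, q) = (3, 2)\<close> (triangles sharing an edge) and \<open>(r, q) = (4, 1)\<close> (copies of \<open>K\<^sub>4\<close> sharing a vertex)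
  are used.
\<close>
definition block_closed :: "'a set \<Rightarrow> 'a set set \<Rightarrow> nat \<Rightarrow> nat \<Rightarrow> 'a set set \<Rightarrow> bool" where
  "block_closed V R r q Y \<longleftrightarrow>
    (\<forall>T\<in>[V]\<^bsup>r\<^esup>. [T]\<^bsup>2\<^esup> \<subseteq> R \<longrightarrow> [T]\<^bsup>q\<^esup> \<inter> Y \<noteq> {} \<longrightarrow> [T]\<^bsup>q\<^esup> \<subseteq> Y)"

text \<open>Defined as a least closed family instead of through chains of blocks: any small closed
  family containing \<open>x\<close> then bounds its size at once.\<close>

definition block_component :: "'a set \<Rightarrow> 'a set set \<Rightarrow> nat \<Rightarrow> nat \<Rightarrow> 'a set \<Rightarrow> 'a set set" where
  "block_component V R r q x = \<Inter>{Y. x \<in> Y \<and> block_closed V R r q Y}"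

lemma block_component_subset:
  "x \<in> Y \<Longrightarrow> block_closed V R r q Y \<Longrightarrow> block_component V R r q x \<subseteq> Y"
  by (auto simp: block_component_def)

lemma block_component_subset_nsets:
  "x \<in> [V]\<^bsup>q\<^esup> \<Longrightarrow> block_component V R r q x \<subseteq> [V]\<^bsup>q\<^esup>"
  by (rule block_component_subset) (auto simp: block_closed_def nsets_def)

lemma block_closed_component: "block_closed V R r q (block_component V R r q x)"
  unfolding block_closed_def block_component_def by blast

lemma block_component_self: "x \<in> block_component V R r q x"
  by (auto simp: block_component_def)

lemma block_subset_component:
  assumes "T \<in> [V]\<^bsup>r\<^esup>" "[T]\<^bsup>2\<^esup> \<subseteq> R" "x \<in> [T]\<^bsup>q\<^esup>"
  shows "[T]\<^bsup>q\<^esup> \<subseteq> block_component V R r q x"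
  using assms block_closed_component[of V R r q x] block_component_self[of x V R r q]
  unfolding block_closed_def by blast

text \<open>Each of the two items lies in the component of the other. Hence data chosen per
  component agree on all items of a block.\<close>

lemma block_component_eq:
  assumes "T \<in> [V]\<^bsup>r\<^esup>" "[T]\<^bsup>2\<^esup> \<subseteq> R" "x \<in> [T]\<^bsup>q\<^esup>" "y \<in> [T]\<^bsup>q\<^esup>"
  shows "block_component V R r q x = block_component V R r q y"
proof
  show "block_component V R r q x \<subseteq> block_component V R r q y"
    using block_subset_component[OF assms(1,2,4)] assms(3)
    by (intro block_component_subset block_closed_component) auto
  show "block_component V R r q y \<subseteq> block_component V R r q x"
    using block_subset_component[OF assms(1,2,3)] assms(4)
    by (intro block_component_subset block_closed_component) auto
qed

text \<open>Local 4-degeneracy.\<close>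

definition sparse_upto :: "'a set \<Rightarrow> 'a set set \<Rightarrow> nat \<Rightarrow> bool" where
  "sparse_upto V R M \<longleftrightarrow>
    (\<forall>S\<subseteq>V. S \<noteq> {} \<longrightarrow> card S \<le> M \<longrightarrow> (\<exists>v\<in>S. card {w \<in> S. w \<noteq> v \<and> {v, w} \<in> R} \<le> 4))"

text \<open>A component has at most \<open>k\<close> items and so spans at most \<open>q * k\<close>
  vertices, on which sparsity yields a proper five-colouring; a clique gets distinct colours. The
  map \<open>\<phi>\<close> takes the component as an argument because a vertex may lie in the span
  of several components, as happens for triangles.\<close>

lemma block_component_colouring:
  assumes V: "finite V" and sparse: "sparse_upto V R (q * k)"
    and small: "\<And>x. x \<in> A \<Longrightarrow> \<exists>Y. x \<in> Y \<and> finite Y \<and> card Y \<le> k \<and> block_closed V R r q Y"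
    and A: "A \<subseteq> [V]\<^bsup>q\<^esup>"
  obtains \<phi> :: "'a set set \<Rightarrow> 'a \<Rightarrow> nat" where
    "\<And>T x. T \<in> [V]\<^bsup>r\<^esup> \<Longrightarrow> [T]\<^bsup>2\<^esup> \<subseteq> R \<Longrightarrow> x \<in> A \<Longrightarrow> x \<in> [T]\<^bsup>q\<^esup> \<Longrightarrow> T \<subseteq> \<Union>([T]\<^bsup>q\<^esup>) \<Longrightarrow>
      \<phi> (block_component V R r q x) ` T \<subseteq> {..<5} \<and> inj_on (\<phi> (block_component V R r q x)) T"
proof -
  have ex: "\<exists>f :: 'a \<Rightarrow> nat. (\<forall>v\<in>\<Union>K. f v < 5) \<and> (\<forall>u\<in>\<Union>K. \<forall>v\<in>\<Union>K. u \<noteq> v \<and> {u, v} \<in> R \<longrightarrow> f u \<noteq> f v)"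
    if K: "K = block_component V R r q x" and x: "x \<in> A" for K x
  proof (rule five_colouring_of_degenerate)
    have KV: "K \<subseteq> [V]\<^bsup>q\<^esup>"
      unfolding K using A x by (intro block_component_subset_nsets) auto
    then have "finite K" "\<Union>K \<subseteq> V"
      using V finite_subset finite_imp_finite_nsets by (blast, auto simp: nsets_def)
    then show "finite (\<Union>K)"
      using V finite_subset by blast
    obtain Y where "x \<in> Y" "finite Y" "card Y \<le> k" "block_closed V R r q Y"
      using small[OF x] by blast
    then have "card K \<le> k"
      using block_component_subset card_mono unfolding K by (metis order_trans)
    then have "card (\<Union>K) \<le> q * k"
      using card_Union_nsets_le[OF KV] by (meson mult_le_mono2 order_trans)
    fix S assume "S \<subseteq> \<Union>K" "S \<noteq> {}"
    then have "card S \<le> q * k" "S \<subseteq> V"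
      using \<open>card (\<Union>K) \<le> q * k\<close> \<open>finite (\<Union>K)\<close> card_mono \<open>\<Union>K \<subseteq> V\<close> by (meson order_trans)+
    then show "\<exists>v\<in>S. card {w \<in> S. w \<noteq> v \<and> {v, w} \<in> R} \<le> 4"
      using sparse \<open>S \<noteq> {}\<close> unfolding sparse_upto_def by blast
  qed
  let ?P = "\<lambda>K (f :: 'a \<Rightarrow> nat). (\<forall>v\<in>\<Union>K. f v < 5) \<and> (\<forall>u\<in>\<Union>K. \<forall>v\<in>\<Union>K. u \<noteq> v \<and> {u, v} \<in> R \<longrightarrow> f u \<noteq> f v)"
  show ?thesis
  proof (rule that[of "\<lambda>K. SOME f. ?P K f"])
    fix T x assume T: "T \<in> [V]\<^bsup>r\<^esup>" "[T]\<^bsup>2\<^esup> \<subseteq> R" "x \<in> A" "x \<in> [T]\<^bsup>q\<^esup>" "T \<subseteq> \<Union>([T]\<^bsup>q\<^esup>)"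
    define K where "K = block_component V R r q x"
    have "?P K (SOME f. ?P K f)"
      using ex[OF K_def T(3)] by (rule someI_ex)
    moreover have "T \<subseteq> \<Union>K"
      using block_subset_component[OF T(1,2,4)] T(5) unfolding K_def by blast
    moreover have "{u, v} \<in> R" if "u \<in> T" "v \<in> T" "u \<noteq> v" for u v
      using T(2) that by auto
    ultimately have "(\<forall>v\<in>T. (SOME f. ?P K f) v < 5) \<and>
        (\<forall>u\<in>T. \<forall>v\<in>T. u \<noteq> v \<longrightarrow> (SOME f. ?P K f) u \<noteq> (SOME f. ?P K f) v)"
      by (meson subsetD)
    then show "(SOME f. ?P K f) ` T \<subseteq> {..<5} \<and> inj_on (SOME f. ?P K f) T"
      unfolding inj_on_def by blast
  qed
qed

text \<open>\<open>K\<^sub>5\<close> is the union of two edge-disjoint pentagons.\<close>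
lemma pentagon_colouring:
  fixes x y z :: nat
  defines "adj \<equiv> \<lambda>x y. y = (x + 1) mod 5 \<or> x = (y + 1) mod 5"
  assumes "x < 5" "y < 5" "z < 5" "x \<noteq> y" "x \<noteq> z" "y \<noteq> z"
  shows "\<not> (adj x y = adj x z \<and> adj x y = adj y z)"
proof -
  have "\<forall>x\<in>set [0..<5]. \<forall>y\<in>set [0..<5]. \<forall>z\<in>set [0..<5]. x \<noteq> y \<longrightarrow> x \<noteq> z \<longrightarrow> y \<noteq> z \<longrightarrow>
    \<not> ((y = (x + 1) mod 5 \<or> x = (y + 1) mod 5) = (z = (x + 1) mod 5 \<or> x = (z + 1) mod 5) \<and>
       (y = (x + 1) mod 5 \<or> x = (y + 1) mod 5) = (z = (y + 1) mod 5 \<or> y = (z + 1) mod (5::nat)))"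
    by code_simp
  then show ?thesis
    using assms(2-) unfolding adj_def by simp
qed

text \<open>An edge is coloured by the pentagon of \<open>K5\<close> into which the colouring of its
  component maps it. The edges of a triangle share a component, so one injective map sends the
  triangle into \<open>K5\<close>, where neither pentagon contains a triangle.\<close>

lemma triangle_free_colouring:
  assumes V: "finite V" and sparse: "sparse_upto V R (2 * k)" and R: "R \<subseteq> [V]\<^bsup>2\<^esup>"
    and small: "\<And>e. e \<in> R \<Longrightarrow> \<exists>Y. e \<in> Y \<and> finite Y \<and> card Y \<le> k \<and> block_closed V R 3 2 Y"
  obtains c :: "'a set \<Rightarrow> bool" where
    "\<And>T. T \<in> [V]\<^bsup>3\<^esup> \<Longrightarrow> [T]\<^bsup>2\<^esup> \<subseteq> R \<Longrightarrow> \<exists>e\<in>[T]\<^bsup>2\<^esup>. \<exists>f\<in>[T]\<^bsup>2\<^esup>. c e \<noteq> c f"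
proof -
  let ?K = "block_component V R 3 2"
  obtain \<phi> :: "'a set set \<Rightarrow> 'a \<Rightarrow> nat" where \<phi>:
    "\<And>T x. T \<in> [V]\<^bsup>3\<^esup> \<Longrightarrow> [T]\<^bsup>2\<^esup> \<subseteq> R \<Longrightarrow> x \<in> R \<Longrightarrow> x \<in> [T]\<^bsup>2\<^esup> \<Longrightarrow> T \<subseteq> \<Union>([T]\<^bsup>2\<^esup>) \<Longrightarrow>
      \<phi> (?K x) ` T \<subseteq> {..<5} \<and> inj_on (\<phi> (?K x)) T"
    using block_component_colouring[OF V sparse small R] by blast
  define adj where "adj = (\<lambda>x y :: nat. y = (x + 1) mod 5 \<or> x = (y + 1) mod 5)"
  define c where "c = (\<lambda>e. \<exists>a\<in>e. \<exists>b\<in>e. a \<noteq> b \<and> adj (\<phi> (?K e) a) (\<phi> (?K e) b))"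
  show ?thesis
  proof (rule that[of c])
    fix T assume T: "T \<in> [V]\<^bsup>3\<^esup>" "[T]\<^bsup>2\<^esup> \<subseteq> R"
    then obtain x y z where xyz: "T = {x, y, z}" "x \<noteq> y" "x \<noteq> z" "y \<noteq> z"
      by (auto simp: nsets_3_eq)
    define f where "f = \<phi> (?K {x, y})"
    have e: "{x, y} \<in> [T]\<^bsup>2\<^esup>" "{x, z} \<in> [T]\<^bsup>2\<^esup>" "{y, z} \<in> [T]\<^bsup>2\<^esup>"
      using xyz by auto
    then have "T \<subseteq> \<Union>([T]\<^bsup>2\<^esup>)"
      using xyz(1) by blast
    then have f: "f ` T \<subseteq> {..<5}" "inj_on f T"
      using \<phi>[OF T, of "{x, y}"] e T(2) unfolding f_def by blast+
    have "?K {x, z} = ?K {x, y}" "?K {y, z} = ?K {x, y}"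
      using block_component_eq[OF T] e by blast+
    then have "c {x, y} = adj (f x) (f y)" "c {x, z} = adj (f x) (f z)" "c {y, z} = adj (f y) (f z)"
      using xyz unfolding c_def f_def adj_def by auto
    moreover have "\<not> (adj (f x) (f y) = adj (f x) (f z) \<and> adj (f x) (f y) = adj (f y) (f z))"
      using f xyz unfolding adj_def by (intro pentagon_colouring) (auto simp: inj_on_def)
    ultimately show "\<exists>e\<in>[T]\<^bsup>2\<^esup>. \<exists>f\<in>[T]\<^bsup>2\<^esup>. c e \<noteq> c f"
      using e by metis
  qed
qed

text \<open>\<open>W\<close> collects the vertices coloured 0 or 1 in their own component. The four
  vertices of a clique have distinct colours among five, so at most two lie below 2 and at most
  three above 1.\<close>

lemma K4_splitting_set:
  assumes V: "finite V" and sparse: "sparse_upto V R k"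
    and small: "\<And>v. v \<in> V \<Longrightarrow> \<exists>Y. {v} \<in> Y \<and> finite Y \<and> card Y \<le> k \<and> block_closed V R 4 1 Y"
  obtains W where "\<And>T. T \<in> [V]\<^bsup>4\<^esup> \<Longrightarrow> [T]\<^bsup>2\<^esup> \<subseteq> R \<Longrightarrow> card (T \<inter> W) \<le> 2 \<and> card (T - W) \<le> 3"
proof -
  let ?K = "block_component V R 4 1"
  have small': "\<exists>Y. x \<in> Y \<and> finite Y \<and> card Y \<le> k \<and> block_closed V R 4 1 Y"
    if "x \<in> [V]\<^bsup>1\<^esup>" for x
    using that small by (auto simp: nsets_one)
  obtain \<phi> :: "'a set set \<Rightarrow> 'a \<Rightarrow> nat" where \<phi>:
    "\<And>T x. T \<in> [V]\<^bsup>4\<^esup> \<Longrightarrow> [T]\<^bsup>2\<^esup> \<subseteq> R \<Longrightarrow> x \<in> [V]\<^bsup>1\<^esup> \<Longrightarrow> x \<in> [T]\<^bsup>1\<^esup> \<Longrightarrow> T \<subseteq> \<Union>([T]\<^bsup>1\<^esup>) \<Longrightarrow>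
      \<phi> (?K x) ` T \<subseteq> {..<5} \<and> inj_on (\<phi> (?K x)) T"
    using block_component_colouring[OF V _ small' subset_refl] sparse by (metis mult_1)
  let ?W = "{v. \<phi> (?K {v}) v < 2}"
  show ?thesis
  proof (rule that[of ?W])
    fix T assume T: "T \<in> [V]\<^bsup>4\<^esup>" "[T]\<^bsup>2\<^esup> \<subseteq> R"
    then have "T \<noteq> {}" "T \<subseteq> V" "finite T"
      by (auto simp: nsets_def)
    then obtain v where v: "v \<in> T"
      by blast
    define f where "f = \<phi> (?K {v})"
    have f: "f ` T \<subseteq> {..<5}" "inj_on f T"
      using \<phi>[OF T, of "{v}"] v \<open>T \<subseteq> V\<close> unfolding f_def by (auto simp: nsets_one)
    have "?K {u} = ?K {v}" if "u \<in> T" for u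
      using block_component_eq[OF T, of "{u}" 1 "{v}"] v that by (auto simp: nsets_one)
    then have W: "u \<in> ?W \<longleftrightarrow> f u < 2" if "u \<in> T" for u
      using that by (simp add: f_def)
    have "card (T \<inter> ?W) \<le> card {..<2::nat}"
      using f W by (intro card_inj_on_le[of f]) (auto intro: inj_on_subset)
    moreover have "card (T - ?W) \<le> card {2..<5::nat}"
      using f W by (intro card_inj_on_le[of f]) (auto intro: inj_on_subset)
    ultimately show "card (T \<inter> ?W) \<le> 2 \<and> card (T - ?W) \<le> 3"
      by simp
  qed
qed

section \<open>Colouring the union of the host graph and the random graph\<close>

definition complete_bipartite :: "'a set \<Rightarrow> 'a set \<Rightarrow> 'a set set" where
  "complete_bipartite A B = (\<lambda>(a, b). {a, b}) ` (A \<times> B)"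

text \<open>A monochromatic clique has at most two vertices in \<open>A\<close> by the choice of
  \<open>c0\<close>. If it has none, it contains a vertex of \<open>W\<close> and two vertices
  outside \<open>W\<close>, hence edges of both colours. If it has some \<open>a\<close> in
  \<open>A\<close>, it has two vertices \<open>x\<close>, \<open>y\<close> in \<open>B\<close>;
  equal colours on \<open>ax\<close> and \<open>ay\<close> put both in \<open>W\<close> or both
  outside, and \<open>xy\<close> then has the opposite colour.\<close>

lemma bipartite_not_ramsey_arrow:
  fixes c0 :: "'a set \<Rightarrow> bool"
  assumes AB: "A \<inter> B = {}"
    and c0: "\<And>T. T \<in> [A]\<^bsup>3\<^esup> \<Longrightarrow> [T]\<^bsup>2\<^esup> \<subseteq> R \<Longrightarrow> \<exists>e\<in>[T]\<^bsup>2\<^esup>. \<exists>f\<in>[T]\<^bsup>2\<^esup>. c0 e \<noteq> c0 f"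
    and W: "\<And>T. T \<in> [B]\<^bsup>4\<^esup> \<Longrightarrow> [T]\<^bsup>2\<^esup> \<subseteq> R \<Longrightarrow> card (T \<inter> W) \<le> 2 \<and> card (T - W) \<le> 3"
  shows "\<not> ramsey_arrow (A \<union> B) (complete_bipartite A B \<union> R) 4"
proof
  let ?G = "complete_bipartite A B"
  \<comment> \<open>The edges in \<open>B\<close> touching \<open>W\<close> are red, and so are the edges between \<open>A\<close> and \<open>B - W\<close>: an edge of
    \<open>B\<close> never has the colour of a common monochromatic pair of edges to \<open>A\<close>.\<close>
  define c where "c = (\<lambda>e. if e \<subseteq> A then c0 e else if e \<subseteq> B then e \<inter> W \<noteq> {} else e \<inter> B \<inter> W = {})"
  assume "ramsey_arrow (A \<union> B) (?G \<union> R) 4"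
  then obtain i S where S: "S \<in> [A \<union> B]\<^bsup>4\<^esup>" "[S]\<^bsup>2\<^esup> \<subseteq> {e \<in> ?G \<union> R. c e = i}"
    unfolding ramsey_arrow_def has_complete_subgraph_def clique_iff_nsets by blast
  have fin: "finite S" "card S = 4" "S \<subseteq> A \<union> B"
    using S(1) by (auto simp: nsets_def)
  have G: "e \<notin> ?G" if "e \<subseteq> A \<or> e \<subseteq> B" for e
    using that AB by (auto simp: complete_bipartite_def)
  have c: "c {x, y} = i" if "x \<in> S" "y \<in> S" "x \<noteq> y" for x y
  proof -
    have "{x, y} \<in> [S]\<^bsup>2\<^esup>"
      using that by simp
    then show ?thesis
      using S(2) by blast
  qed
  have A2: "card (S \<inter> A) \<le> 2"
  proof (rule ccontr)
    assume "\<not> ?thesis"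
    then obtain T where T: "T \<subseteq> S \<inter> A" "card T = 3" "finite T"
      using obtain_subset_with_card_n[of 3 "S \<inter> A"] by auto
    then have T3: "T \<in> [A]\<^bsup>3\<^esup>"
      by (auto simp: nsets_def)
    have TS: "[T]\<^bsup>2\<^esup> \<subseteq> [S]\<^bsup>2\<^esup>" and TA: "[T]\<^bsup>2\<^esup> \<subseteq> Pow A"
      using T by (auto simp: nsets_def)
    have "[T]\<^bsup>2\<^esup> \<subseteq> R"
    proof
      fix e assume "e \<in> [T]\<^bsup>2\<^esup>"
      then have "e \<in> ?G \<union> R" "e \<subseteq> A"
        using TS TA S(2) by blast+
      then show "e \<in> R"
        using G[of e] by simp
    qed
    then obtain e f where ef: "e \<in> [T]\<^bsup>2\<^esup>" "f \<in> [T]\<^bsup>2\<^esup>" "c0 e \<noteq> c0 f"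
      using c0[OF T3] by blast
    then have "e \<subseteq> A" "f \<subseteq> A"
      using TA by blast+
    then have "c e \<noteq> c f"
      using ef(3) unfolding c_def by simp
    moreover have "c e = i" "c f = i"
      using ef(1,2) TS S(2) by blast+
    ultimately show False
      by simp
  qed
  have cB: "c {x, y} \<longleftrightarrow> x \<in> W \<or> y \<in> W" if "x \<in> B" "y \<in> B" for x y
    using that AB unfolding c_def by auto
  have cAB: "c {x, y} \<longleftrightarrow> y \<notin> W" if "x \<in> A" "y \<in> B" for x y
    using that AB unfolding c_def by auto
  show False
  proof (cases "S \<inter> A = {}")
    case True
    then have SB: "S \<subseteq> B"
      using fin by auto
    then have "S \<in> [B]\<^bsup>4\<^esup>"
      using fin by (auto simp: nsets_def)
    moreover have "[S]\<^bsup>2\<^esup> \<subseteq> R"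
    proof
      fix e assume e: "e \<in> [S]\<^bsup>2\<^esup>"
      then have "e \<in> ?G \<union> R"
        using S(2) by blast
      moreover have "e \<subseteq> B"
        using e SB by (auto simp: nsets_def)
      ultimately show "e \<in> R"
        using G[of e] by simp
    qed
    ultimately have "card (S \<inter> W) \<le> 2" "card (S - W) \<le> 3"
      using W by blast+
    moreover have "card S = card (S \<inter> W) + card (S - W)"
      using fin card_Int_Diff by blast
    ultimately have "1 \<le> card (S \<inter> W)" "2 \<le> card (S - W)"
      using fin by linarith+
    then obtain w D where w: "w \<in> S" "w \<in> W" and D: "D \<subseteq> S - W" "card D = 2"
      using obtain_subset_with_card_n[of 2 "S - W"]
      by (metis IntE card.empty ex_in_conv not_one_le_zero)
    then obtain x y where "x \<in> S - W" "y \<in> S - W" "x \<noteq> y"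
      by (auto simp: card_2_iff)
    then show False
      using c[of w x] c[of x y] cB[of w x] cB[of x y] w SB by blast
  next
    case False
    then obtain a where a: "a \<in> S" "a \<in> A"
      by auto
    have "S \<inter> B = S - A"
      using fin AB by blast
    then have "2 \<le> card (S \<inter> B)"
      using A2 fin card_Int_Diff[of S A] by simp
    then obtain D where "D \<subseteq> S \<inter> B" "card D = 2"
      using obtain_subset_with_card_n[of 2 "S \<inter> B"] by blast
    then obtain x y where "x \<in> S \<inter> B" "y \<in> S \<inter> B" "x \<noteq> y"
      by (auto simp: card_2_iff)
    then show False
      using c[of a x] c[of a y] c[of x y] cAB[of a x] cAB[of a y] cB[of x y] a AB by blast
  qed
qed

subsection \<open>Exploring components\<close>

text \<open>
  A breadth-first search with queue \<open>ts\<close> and discovered set \<open>X\<close>: the letter \<^const>\<open>False\<close> discards the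
  head of the queue, \<^const>\<open>True\<close> reveals a block through the head that has an undiscovered item. Since
  the head is prescribed, there are only exponentially many patterns, whereas choosing the block to be
  extended freely would cost a factorial.
\<close>
fun exploration :: "'a set \<Rightarrow> 'a set set \<Rightarrow> nat \<Rightarrow> nat \<Rightarrow> bool list \<Rightarrow> 'a set list \<Rightarrow> 'a set set \<Rightarrow> bool" where
  "exploration V R r q [] ts X \<longleftrightarrow> True"
| "exploration V R r q (b # bs) [] X \<longleftrightarrow> False"
| "exploration V R r q (False # bs) (x # ts) X \<longleftrightarrow> exploration V R r q bs ts X"
| "exploration V R r q (True # bs) (x # ts) X \<longleftrightarrow>
    (\<exists>T\<in>[V]\<^bsup>r\<^esup>. x \<in> [T]\<^bsup>q\<^esup> \<and> \<not> [T]\<^bsup>q\<^esup> \<subseteq> X \<and> [T]\<^bsup>2\<^esup> \<subseteq> R \<and>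
      exploration V R r q bs (x # ts @ (SOME l. set l = [T]\<^bsup>q\<^esup> - X \<and> distinct l)) (X \<union> [T]\<^bsup>q\<^esup>))"

lemma enumerate_finite:
  assumes "finite A"
  shows "set (SOME l. set l = A \<and> distinct l) = A \<and> length (SOME l. set l = A \<and> distinct l) = card A"
proof -
  have "set (SOME l. set l = A \<and> distinct l) = A \<and> distinct (SOME l. set l = A \<and> distinct l)"
    by (rule someI_ex) (use finite_distinct_list[OF assms] in blast)
  then show ?thesis
    by (metis distinct_card)
qed

text \<open>A block has at most four items and one of them, \<open>x\<close>, is already
  known.\<close>

lemma card_new_items:
  assumes rq: "r choose q \<le> 4" and T: "T \<in> [V]\<^bsup>r\<^esup>" and x: "x \<in> [T]\<^bsup>q\<^esup>" "x \<in> X"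
  shows "finite ([T]\<^bsup>q\<^esup>)" "card ([T]\<^bsup>q\<^esup> - X) \<le> 3" "card (X \<union> [T]\<^bsup>q\<^esup>) \<le> card X + 3"
proof -
  show fin: "finite ([T]\<^bsup>q\<^esup>)"
    using T by (auto simp: nsets_def)
  have "card ([T]\<^bsup>q\<^esup>) = r choose q"
  proof -
    have "card T = r"
      using T by (simp add: nsets_def)
    then show ?thesis
      by simp
  qed
  moreover have "card ([T]\<^bsup>q\<^esup> - X) < card ([T]\<^bsup>q\<^esup>)"
    using x by (intro psubset_card_mono fin) auto
  ultimately show *: "card ([T]\<^bsup>q\<^esup> - X) \<le> 3"
    using rq by simp
  show "card (X \<union> [T]\<^bsup>q\<^esup>) \<le> card X + 3"
    using card_Un_le[of X "[T]\<^bsup>q\<^esup> - X"] * by simp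
qed

text \<open>The search runs until \<open>m\<close> blocks are revealed or the queue is empty. The
  last hypothesis says that items which have left the queue are exhausted, so an empty queue makes
  \<open>X\<close> closed. A reveal adds at most three items to the queue; thus at most
  \<open>length ts + 3 * m\<close> discards accompany the \<open>m\<close> reveals.\<close>

lemma exploration_or_block_closed:
  assumes rq: "r choose q \<le> 4"
    and "finite X" "set ts \<subseteq> X"
    and "\<And>x T. x \<in> X - set ts \<Longrightarrow> T \<in> [V]\<^bsup>r\<^esup> \<Longrightarrow> x \<in> [T]\<^bsup>q\<^esup> \<Longrightarrow> [T]\<^bsup>2\<^esup> \<subseteq> R \<Longrightarrow> [T]\<^bsup>q\<^esup> \<subseteq> X"
  shows "(\<exists>bs. count_list bs True = m \<and> length bs \<le> length ts + 4 * m \<and> exploration V R r q bs ts X)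
    \<or> (\<exists>Y. X \<subseteq> Y \<and> finite Y \<and> card Y \<le> card X + 3 * m \<and> block_closed V R r q Y)"
  using assms(2-)
proof (induction m arbitrary: ts X)
  case 0
  then show ?case
    by (intro disjI1 exI[of _ "[]"]) auto
next
  case (Suc m)
  note outer = Suc.IH
  show ?case
    using Suc.prems
  \<comment> \<open>The inner induction handles discards, which shorten the queue without changing
    \<open>m\<close>; a reveal lengthens the queue and uses the outer hypothesis.\<close>
  proof (induction ts)
    case Nil
    then have "block_closed V R r q X"
      unfolding block_closed_def by auto
    then show ?case
      using Nil by auto
  next
    case (Cons x ts)
    show ?case
    proof (cases "\<exists>T\<in>[V]\<^bsup>r\<^esup>. x \<in> [T]\<^bsup>q\<^esup> \<and> \<not> [T]\<^bsup>q\<^esup> \<subseteq> X \<and> [T]\<^bsup>2\<^esup> \<subseteq> R")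
      case False
      have "(\<exists>bs. count_list bs True = Suc m \<and> length bs \<le> length ts + 4 * Suc m \<and> exploration V R r q bs ts X)
        \<or> (\<exists>Y. X \<subseteq> Y \<and> finite Y \<and> card Y \<le> card X + 3 * Suc m \<and> block_closed V R r q Y)"
      proof (rule Cons.IH)
        fix y T assume "y \<in> X - set ts" "T \<in> [V]\<^bsup>r\<^esup>" "y \<in> [T]\<^bsup>q\<^esup>" "[T]\<^bsup>2\<^esup> \<subseteq> R"
        then show "[T]\<^bsup>q\<^esup> \<subseteq> X"
          using False Cons.prems(3)[of y T] by (cases "y = x") auto
      qed (use Cons.prems in auto)
      then show ?thesis
      proof (elim disjE exE conjE)
        fix bs assume "count_list bs True = Suc m" "length bs \<le> length ts + 4 * Suc m"
          "exploration V R r q bs ts X"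
        then show ?thesis
          by (intro disjI1 exI[of _ "False # bs"]) auto
      qed blast
    next
      case True
      then obtain T where T: "T \<in> [V]\<^bsup>r\<^esup>" "x \<in> [T]\<^bsup>q\<^esup>" "\<not> [T]\<^bsup>q\<^esup> \<subseteq> X" "[T]\<^bsup>2\<^esup> \<subseteq> R"
        by blast
      have "x \<in> X"
        using Cons.prems by auto
      note new = card_new_items[OF rq T(1,2) this]
      define l where "l = (SOME l. set l = [T]\<^bsup>q\<^esup> - X \<and> distinct l)"
      have l: "set l = [T]\<^bsup>q\<^esup> - X" "length l \<le> 3"
        using enumerate_finite[of "[T]\<^bsup>q\<^esup> - X"] new by (auto simp: l_def)
      have "(\<exists>bs. count_list bs True = m \<and> length bs \<le> length (x # ts @ l) + 4 * m
            \<and> exploration V R r q bs (x # ts @ l) (X \<union> [T]\<^bsup>q\<^esup>))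
        \<or> (\<exists>Y. X \<union> [T]\<^bsup>q\<^esup> \<subseteq> Y \<and> finite Y \<and> card Y \<le> card (X \<union> [T]\<^bsup>q\<^esup>) + 3 * m \<and> block_closed V R r q Y)"
      proof (rule outer)
        show "finite (X \<union> [T]\<^bsup>q\<^esup>)"
          using Cons.prems new by simp
        show "set (x # ts @ l) \<subseteq> X \<union> [T]\<^bsup>q\<^esup>"
          using Cons.prems l by auto
        fix y T' assume y: "y \<in> X \<union> [T]\<^bsup>q\<^esup> - set (x # ts @ l)"
          and T': "T' \<in> [V]\<^bsup>r\<^esup>" "y \<in> [T']\<^bsup>q\<^esup>" "[T']\<^bsup>2\<^esup> \<subseteq> R"
        have "y \<in> X - set (x # ts)"
          using y l by auto
        then show "[T']\<^bsup>q\<^esup> \<subseteq> X \<union> [T]\<^bsup>q\<^esup>"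
          using Cons.prems(3)[of y T'] T' by auto
      qed
      then show ?thesis
      proof (elim disjE exE conjE)
        fix bs assume bs: "count_list bs True = m" "length bs \<le> length (x # ts @ l) + 4 * m"
          "exploration V R r q bs (x # ts @ l) (X \<union> [T]\<^bsup>q\<^esup>)"
        have "exploration V R r q (True # bs) (x # ts) X"
          unfolding exploration.simps
          using T bs(3)[unfolded l_def] by (intro bexI[of _ T]) auto
        then show ?thesis
          using bs l(2) by (intro disjI1 exI[of _ "True # bs"]) auto
      next
        fix Y assume Y: "X \<union> [T]\<^bsup>q\<^esup> \<subseteq> Y" "finite Y" "card Y \<le> card (X \<union> [T]\<^bsup>q\<^esup>) + 3 * m" "block_closed V R r q Y"
        then show ?thesis
          using new(3) by (intro disjI2 exI[of _ Y]) auto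
      qed
    qed
  qed
qed

text \<open>\<open>E\<close> holds the edges required so far, and the invariant \<open>I\<close>
  ties it to the discovered items. A discard costs nothing; a reveal costs a union bound over the
  blocks at the head, weighted by \<open>p\<close> to the number of new edges, which
  \<open>step\<close> bounds by \<open>\<alpha>\<close>. The slack 3 in the size condition reflects
  that \<open>card X \<le> M\<close> is required only while a reveal is still to come.\<close>

lemma prob_exploration_le:
  fixes p \<alpha> :: real
  assumes V: "finite V" and p: "0 \<le> p" "p \<le> 1" and rq: "r choose q \<le> 4" and \<alpha>: "0 \<le> \<alpha>"
    and inv: "\<And>E X x T. I E X \<Longrightarrow> x \<in> X \<Longrightarrow> T \<in> [V]\<^bsup>r\<^esup> \<Longrightarrow> x \<in> [T]\<^bsup>q\<^esup> \<Longrightarrow> I (E \<union> [T]\<^bsup>2\<^esup>) (X \<union> [T]\<^bsup>q\<^esup>)"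
    and step: "\<And>E X x. I E X \<Longrightarrow> finite E \<Longrightarrow> finite X \<Longrightarrow> card X \<le> M \<Longrightarrow> x \<in> X \<Longrightarrow>
      (\<Sum>T\<in>{T\<in>[V]\<^bsup>r\<^esup>. x \<in> [T]\<^bsup>q\<^esup> \<and> \<not> [T]\<^bsup>q\<^esup> \<subseteq> X}. p ^ card ([T]\<^bsup>2\<^esup> - E)) \<le> \<alpha>"
    and "I E X" "finite E" "finite X" "set ts \<subseteq> X" "card X + 3 * count_list bs True \<le> M + 3"
  shows "measure_pmf.prob (percolation ([V]\<^bsup>2\<^esup>) p) {R. E \<subseteq> R \<and> exploration V R r q bs ts X}
    \<le> p ^ card E * \<alpha> ^ count_list bs True"
  using assms(8-)
proof (induction bs arbitrary: E X ts)
  case Nil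
  have "measure_pmf.prob (percolation ([V]\<^bsup>2\<^esup>) p) {R. E \<subseteq> R} \<le> p ^ card E"
    using V p Nil by (intro prob_percolation_superset_le) (auto simp: finite_imp_finite_nsets)
  then show ?case
    by simp
next
  case (Cons b bs)
  let ?P = "\<lambda>Z. measure_pmf.prob (percolation ([V]\<^bsup>2\<^esup>) p) {R. Z R}"
  show ?case
  proof (cases ts)
    case Nil
    then show ?thesis
      using p \<alpha> by simp
  next
    case ts: (Cons x ts')
    show ?thesis
    proof (cases b)
      case False
      then show ?thesis
        using Cons.IH[of E X ts'] Cons.prems ts by auto
    next
      case True
      then have True: "b = True"
        by simp
      have x: "x \<in> X"
        using Cons.prems ts by auto
      let ?T = "{T\<in>[V]\<^bsup>r\<^esup>. x \<in> [T]\<^bsup>q\<^esup> \<and> \<not> [T]\<^bsup>q\<^esup> \<subseteq> X}"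
      let ?ts = "\<lambda>T. x # ts' @ (SOME l. set l = [T]\<^bsup>q\<^esup> - X \<and> distinct l)"
      have "?P (\<lambda>R. E \<subseteq> R \<and> exploration V R r q (b # bs) ts X)
        \<le> (\<Sum>T\<in>?T. ?P (\<lambda>R. E \<union> [T]\<^bsup>2\<^esup> \<subseteq> R \<and> exploration V R r q bs (?ts T) (X \<union> [T]\<^bsup>q\<^esup>)))"
        using V unfolding ts True
        by (intro prob_percolation_union_bound) (auto simp: finite_imp_finite_nsets)
      also have "\<dots> \<le> (\<Sum>T\<in>?T. p ^ card (E \<union> [T]\<^bsup>2\<^esup>) * \<alpha> ^ count_list bs True)"
      proof (rule sum_mono)
        fix T assume T: "T \<in> ?T"
        then have "T \<in> [V]\<^bsup>r\<^esup>" "x \<in> [T]\<^bsup>q\<^esup>"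
          by auto
        note new = card_new_items[OF rq this x]
        have "set (?ts T) \<subseteq> X \<union> [T]\<^bsup>q\<^esup>"
          using enumerate_finite[of "[T]\<^bsup>q\<^esup> - X"] new(1) Cons.prems ts by auto
        moreover have "finite ([T]\<^bsup>2\<^esup>)"
          using T by (auto simp: nsets_def)
        ultimately show "?P (\<lambda>R. E \<union> [T]\<^bsup>2\<^esup> \<subseteq> R \<and> exploration V R r q bs (?ts T) (X \<union> [T]\<^bsup>q\<^esup>))
            \<le> p ^ card (E \<union> [T]\<^bsup>2\<^esup>) * \<alpha> ^ count_list bs True"
          using Cons.prems T x new True by (intro Cons.IH inv) auto
      qed
      also have "\<dots> = (p ^ card E * \<alpha> ^ count_list bs True) * (\<Sum>T\<in>?T. p ^ card ([T]\<^bsup>2\<^esup> - E))"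
        unfolding sum_distrib_left
      proof (rule sum.cong[OF refl])
        fix T assume "T \<in> ?T"
        then have "finite ([T]\<^bsup>2\<^esup>)"
          by (auto simp: nsets_def)
        then have "card (E \<union> [T]\<^bsup>2\<^esup>) = card E + card ([T]\<^bsup>2\<^esup> - E)"
          using card_Un_disjoint[of E "[T]\<^bsup>2\<^esup> - E"] Cons.prems by simp
        then show "p ^ card (E \<union> [T]\<^bsup>2\<^esup>) * \<alpha> ^ count_list bs True
            = p ^ card E * \<alpha> ^ count_list bs True * p ^ card ([T]\<^bsup>2\<^esup> - E)"
          by (simp add: power_add)
      qed
      also have "\<dots> \<le> (p ^ card E * \<alpha> ^ count_list bs True) * \<alpha>"
        using Cons.prems True x p \<alpha> by (intro mult_left_mono step) auto
      finally show ?thesis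
        using True by (simp add: mult_ac)
    qed
  qed
qed

lemma card_bool_lists_le: "card {bs :: bool list. length bs \<le> L} \<le> 2 ^ Suc L"
proof -
  have "card {bs :: bool list. length bs \<le> L} = (\<Sum>i\<le>L. 2 ^ i)"
    using card_lists_length_le[of "UNIV :: bool set" L] by simp
  also have "\<dots> \<le> 2 ^ Suc L"
    by (induction L) auto
  finally show ?thesis .
qed

text \<open>If no small closed family contains \<open>x\<close>, the search from \<open>x\<close>
  achieves \<open>m\<close> reveals. There are at most \<open>2 ^ (4 * m + 2)\<close> patterns, the
  source of the factors 4 and 16, each of probability at most \<open>\<alpha> ^ m\<close>.\<close>

lemma prob_no_small_block_closed_le:
  fixes p \<alpha> :: real
  assumes V: "finite V" and p: "0 \<le> p" "p \<le> 1" and rq: "r choose q \<le> 4" and \<alpha>: "0 \<le> \<alpha>"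
    and inv: "\<And>E X x T. I E X \<Longrightarrow> x \<in> X \<Longrightarrow> T \<in> [V]\<^bsup>r\<^esup> \<Longrightarrow> x \<in> [T]\<^bsup>q\<^esup> \<Longrightarrow> I (E \<union> [T]\<^bsup>2\<^esup>) (X \<union> [T]\<^bsup>q\<^esup>)"
    and step: "\<And>E X x. I E X \<Longrightarrow> finite E \<Longrightarrow> finite X \<Longrightarrow> card X \<le> 3 * m + 1 \<Longrightarrow> x \<in> X \<Longrightarrow>
      (\<Sum>T\<in>{T\<in>[V]\<^bsup>r\<^esup>. x \<in> [T]\<^bsup>q\<^esup> \<and> \<not> [T]\<^bsup>q\<^esup> \<subseteq> X}. p ^ card ([T]\<^bsup>2\<^esup> - E)) \<le> \<alpha>"
    and S: "finite \<S>" "\<And>x. x \<in> \<S> \<Longrightarrow> I (E0 x) {x} \<and> finite (E0 x)"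
  shows "measure_pmf.prob (percolation ([V]\<^bsup>2\<^esup>) p)
      {R. \<exists>x\<in>\<S>. E0 x \<subseteq> R \<and> \<not> (\<exists>Y. x \<in> Y \<and> finite Y \<and> card Y \<le> 3 * m + 1 \<and> block_closed V R r q Y)}
    \<le> 4 * real (card \<S>) * (16 * \<alpha>) ^ m"
proof -
  let ?P = "\<lambda>Z. measure_pmf.prob (percolation ([V]\<^bsup>2\<^esup>) p) {R. Z R}"
  let ?B = "{bs :: bool list. length bs \<le> 1 + 4 * m \<and> count_list bs True = m}"
  have sub: "?B \<subseteq> {bs. length bs \<le> 1 + 4 * m}"
    by auto
  have "finite {bs :: bool list. set bs \<subseteq> UNIV \<and> length bs \<le> 1 + 4 * m}"
    by (rule finite_lists_length_le) simp
  then have fin: "finite {bs :: bool list. length bs \<le> 1 + 4 * m}"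
    by simp
  then have B: "finite ?B" "card ?B \<le> 2 ^ (4 * m + 2)"
    using finite_subset[OF sub] card_mono[OF fin sub] card_bool_lists_le[of "1 + 4 * m"] by auto
  have "?P (\<lambda>R. \<exists>x\<in>\<S>. E0 x \<subseteq> R \<and> \<not> (\<exists>Y. x \<in> Y \<and> finite Y \<and> card Y \<le> 3 * m + 1 \<and> block_closed V R r q Y))
    \<le> (\<Sum>(x, bs)\<in>\<S> \<times> ?B. ?P (\<lambda>R. E0 x \<subseteq> R \<and> exploration V R r q bs [x] {x}))"
    unfolding case_prod_beta
  proof (rule prob_percolation_union_bound)
    fix R assume "\<exists>x\<in>\<S>. E0 x \<subseteq> R \<and> \<not> (\<exists>Y. x \<in> Y \<and> finite Y \<and> card Y \<le> 3 * m + 1 \<and> block_closed V R r q Y)"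
    then obtain x where x: "x \<in> \<S>" "E0 x \<subseteq> R"
      and no: "\<not> (\<exists>Y. x \<in> Y \<and> finite Y \<and> card Y \<le> 3 * m + 1 \<and> block_closed V R r q Y)"
      by blast
    have "(\<exists>bs. count_list bs True = m \<and> length bs \<le> length [x] + 4 * m \<and> exploration V R r q bs [x] {x})
      \<or> (\<exists>Y. {x} \<subseteq> Y \<and> finite Y \<and> card Y \<le> card {x} + 3 * m \<and> block_closed V R r q Y)"
      by (rule exploration_or_block_closed[OF rq]) auto
    then obtain bs where "count_list bs True = m" "length bs \<le> 1 + 4 * m" "exploration V R r q bs [x] {x}"
      using no by auto
    then show "\<exists>z\<in>\<S> \<times> ?B. E0 (fst z) \<subseteq> R \<and> exploration V R r q (snd z) [fst z] {fst z}"
      using x by force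
  qed (use V S B in \<open>auto simp: finite_imp_finite_nsets\<close>)
  also have "\<dots> \<le> (\<Sum>(x, bs)\<in>\<S> \<times> ?B. \<alpha> ^ m)"
  proof (rule sum_mono, clarify)
    fix x and bs :: "bool list" assume x: "x \<in> \<S>" and bs: "m = count_list bs True"
    have "?P (\<lambda>R. E0 x \<subseteq> R \<and> exploration V R r q bs [x] {x}) \<le> p ^ card (E0 x) * \<alpha> ^ count_list bs True"
      using S(2)[OF x] bs by (intro prob_exploration_le[where I = I and M = "3 * m + 1", OF V p rq \<alpha> inv step]) auto
    also have "\<dots> \<le> 1 * \<alpha> ^ count_list bs True"
      using p \<alpha> by (intro mult_right_mono power_le_one) auto
    finally show "?P (\<lambda>R. E0 x \<subseteq> R \<and> exploration V R r q bs [x] {x}) \<le> \<alpha> ^ count_list bs True"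
      by simp
  qed
  also have "\<dots> = real (card \<S>) * (real (card ?B) * \<alpha> ^ m)"
    by (simp add: card_cartesian_product)
  also have "\<dots> \<le> real (card \<S>) * (2 ^ (4 * m + 2) * \<alpha> ^ m)"
    using B(2) \<alpha> by (intro mult_left_mono mult_right_mono) (auto simp flip: of_nat_le_iff[where 'a = real])
  also have "\<dots> = 4 * real (card \<S>) * (16 * \<alpha>) ^ m"
    by (simp add: power_add power_mult power_mult_distrib)
  finally show ?thesis .
qed

text \<open>If the third vertex lies outside the span \<open>?U\<close> of \<open>X\<close>, there
  are at most \<open>card V\<close> choices and two new edges. Otherwise there are at most
  \<open>2 * M\<close> choices and at least one new edge.\<close>

lemma triangle_step_le:
  fixes p :: real
  assumes V: "finite V" and p: "0 \<le> p" "p \<le> 1" and X: "finite X" "X \<subseteq> [V]\<^bsup>2\<^esup>" "card X \<le> M" and x: "x \<in> X"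
  shows "(\<Sum>T\<in>{T\<in>[V]\<^bsup>3\<^esup>. x \<in> [T]\<^bsup>2\<^esup> \<and> \<not> [T]\<^bsup>2\<^esup> \<subseteq> X}. p ^ card ([T]\<^bsup>2\<^esup> - X))
    \<le> real (card V) * p\<^sup>2 + 2 * real M * p"
proof -
  let ?U = "\<Union>X"
  let ?T = "{T\<in>[V]\<^bsup>3\<^esup>. x \<in> [T]\<^bsup>2\<^esup> \<and> \<not> [T]\<^bsup>2\<^esup> \<subseteq> X}"
  let ?T1 = "{T\<in>?T. T \<inter> ?U = x}"
  have finU: "finite ?U"
    using X V by (auto simp: nsets_def)
  have fin: "finite ?T"
    using V by (simp add: finite_imp_finite_nsets)
  have x2: "finite x" "card x = 2" "x \<subseteq> ?U"
    using x X by (auto simp: nsets_def)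
  have "(\<Sum>T\<in>?T1. p ^ card ([T]\<^bsup>2\<^esup> - X)) \<le> (\<Sum>J\<in>{x}. real (card V) ^ (3 - card J) * p ^ ((3 choose 2) - (card J choose 2)))"
    using x2 X by (intro sum_new_edges_le[OF V p, where U = ?U]) (auto simp: nsets_def)
  then have 1: "(\<Sum>T\<in>?T1. p ^ card ([T]\<^bsup>2\<^esup> - X)) \<le> real (card V) * p\<^sup>2"
    using x2 by (simp add: choose_two)
  have T2: "T \<in> (\<lambda>w. insert w x) ` ?U" if T: "T \<in> ?T - ?T1" for T
  proof -
    have T': "x \<subseteq> T" "finite T" "card T = 3" "T \<inter> ?U \<noteq> x"
      using T by (auto simp: nsets_def)
    then obtain w where w: "w \<in> T" "w \<in> ?U" "w \<notin> x"
      using x2 by blast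
    then have "card (insert w x) = 3"
      using x2 by simp
    then have "insert w x = T"
      using T' w by (intro card_subset_eq) auto
    then show ?thesis
      using w by blast
  qed
  have "(\<Sum>T\<in>?T - ?T1. p ^ card ([T]\<^bsup>2\<^esup> - X)) \<le> (\<Sum>T\<in>?T - ?T1. p)"
  proof (rule sum_mono)
    fix T assume "T \<in> ?T - ?T1"
    then have "finite ([T]\<^bsup>2\<^esup> - X)" "[T]\<^bsup>2\<^esup> - X \<noteq> {}"
      by (auto simp: nsets_def)
    then have "1 \<le> card ([T]\<^bsup>2\<^esup> - X)"
      by (simp add: Suc_le_eq card_gt_0_iff)
    then show "p ^ card ([T]\<^bsup>2\<^esup> - X) \<le> p"
      using power_decreasing[of 1 _ p] p by simp
  qed
  also have "\<dots> = real (card (?T - ?T1)) * p"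
    by simp
  also have "\<dots> \<le> real (2 * M) * p"
  proof (intro mult_right_mono p)
    have "card (?T - ?T1) \<le> card ?U"
      by (rule surj_card_le[OF finU]) (rule subsetI, rule T2)
    also have "\<dots> \<le> 2 * M"
      using card_Union_nsets_le[OF X(2)] X(3) by linarith
    finally show "real (card (?T - ?T1)) \<le> real (2 * M)"
      by simp
  qed
  finally have 2: "(\<Sum>T\<in>?T - ?T1. p ^ card ([T]\<^bsup>2\<^esup> - X)) \<le> 2 * real M * p"
    by simp
  have "(\<Sum>T\<in>?T. p ^ card ([T]\<^bsup>2\<^esup> - X))
      = (\<Sum>T\<in>?T - ?T1. p ^ card ([T]\<^bsup>2\<^esup> - X)) + (\<Sum>T\<in>?T1. p ^ card ([T]\<^bsup>2\<^esup> - X))"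
    using fin by (intro sum.subset_diff) auto
  then show ?thesis
    using 1 2 by linarith
qed

text \<open>Classify by the number \<open>j\<close> of vertices of \<open>T\<close> already
  discovered. It is at least 1 because of \<open>x\<close> and at most 3 because some item is new.
  There are at most \<open>M ^ (j - 1)\<close> traces containing \<open>x\<close>.\<close>

lemma K4_step_le:
  fixes p :: real
  assumes V: "finite V" and p: "0 \<le> p" "p \<le> 1" and X: "finite X" "X \<subseteq> [V]\<^bsup>1\<^esup>" "card X \<le> M" and x: "x \<in> X"
    and E: "E \<subseteq> [\<Union>X]\<^bsup>2\<^esup>"
  shows "(\<Sum>T\<in>{T\<in>[V]\<^bsup>4\<^esup>. x \<in> [T]\<^bsup>1\<^esup> \<and> \<not> [T]\<^bsup>1\<^esup> \<subseteq> X}. p ^ card ([T]\<^bsup>2\<^esup> - E))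
    \<le> real (card V) ^ 3 * p ^ 6 + real M * (real (card V) ^ 2 * p ^ 5) + real M ^ 2 * (real (card V) * p ^ 3)"
proof -
  let ?U = "\<Union>X"
  let ?T = "{T\<in>[V]\<^bsup>4\<^esup>. x \<in> [T]\<^bsup>1\<^esup> \<and> \<not> [T]\<^bsup>1\<^esup> \<subseteq> X}"
  let ?J = "\<lambda>j. {J\<in>[?U]\<^bsup>j\<^esup>. J \<inter> x = x}"
  let ?h = "\<lambda>j. real (card V) ^ (4 - j) * p ^ ((4 choose 2) - (j choose 2))"
  have finU: "finite ?U"
    using X V by (auto simp: nsets_def)
  have U: "card ?U \<le> M"
    using card_Union_nsets_le[OF X(2)] X(3) by simp
  obtain v where v: "x = {v}"
    using x X(2) by (auto simp: nsets_one)
  have sing: "{w} \<in> X" if "w \<in> ?U" for w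
    using that X(2) by (auto simp: nsets_one)
  have finJ: "finite (?J j)" for j
    using finU by (simp add: finite_imp_finite_nsets)
  have J: "real (card (?J j)) \<le> real M ^ (j - 1)" for j
  proof -
    have "card (?J j) \<le> card ?U ^ (j - card x)"
      using finU by (intro card_nsets_Int_eq_le) (auto simp: v)
    also have "\<dots> \<le> M ^ (j - card x)"
      using U by (intro power_mono) auto
    finally show ?thesis
      by (simp add: v flip: of_nat_power)
  qed
  have "(\<Sum>T\<in>?T. p ^ card ([T]\<^bsup>2\<^esup> - E)) \<le> (\<Sum>J\<in>(\<Union>j\<in>{1,2,3}. ?J j). ?h (card J))"
  proof (rule sum_new_edges_le[OF V p E])
    fix T assume T: "T \<in> ?T"
    then have T': "finite T" "card T = 4" "v \<in> T"
      by (auto simp: nsets_def v nsets_one)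
    have "v \<in> ?U"
      using x v by blast
    have "T \<inter> ?U \<noteq> T"
    proof
      assume "T \<inter> ?U = T"
      then have "[T]\<^bsup>1\<^esup> \<subseteq> X"
        using sing by (auto simp: nsets_one)
      then show False
        using T by blast
    qed
    then have "card (T \<inter> ?U) < 4"
      using T' psubset_card_mono[of T "T \<inter> ?U"] by auto
    moreover have "card (T \<inter> ?U) > 0"
      using T' \<open>v \<in> ?U\<close> by (auto simp: card_gt_0_iff)
    ultimately have "card (T \<inter> ?U) = 1 \<or> card (T \<inter> ?U) = 2 \<or> card (T \<inter> ?U) = 3"
      by linarith
    then show "T \<inter> ?U \<in> (\<Union>j\<in>{1,2,3}. ?J j)"
      using T' \<open>v \<in> ?U\<close> by (auto simp: nsets_def v)
  qed (use finJ in \<open>auto simp: nsets_def\<close>)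
  also have "\<dots> = (\<Sum>j\<in>{1,2,3}. \<Sum>J\<in>?J j. ?h (card J))"
    using finJ by (intro sum.UNION_disjoint) (auto simp: nsets_def)
  also have "\<dots> = (\<Sum>j\<in>{1,2,3}. real (card (?J j)) * ?h j)"
    by (intro sum.cong refl) (simp add: nsets_def)
  also have "\<dots> \<le> (\<Sum>j\<in>{1,2,3}. real M ^ (j - 1) * ?h j)"
    using p by (intro sum_mono mult_right_mono J) auto
  also have "\<dots> = real (card V) ^ 3 * p ^ 6 + real M * (real (card V) ^ 2 * p ^ 5) + real M ^ 2 * (real (card V) * p ^ 3)"
    by (simp add: choose_two)
  finally show ?thesis .
qed

lemma prob_triangle_component_le:
  fixes p :: real
  assumes V: "finite V" and p: "0 \<le> p" "p \<le> 1"
  shows "measure_pmf.prob (percolation ([V]\<^bsup>2\<^esup>) p)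
      {R. \<exists>e\<in>R. \<not> (\<exists>Y. e \<in> Y \<and> finite Y \<and> card Y \<le> 3 * m + 1 \<and> block_closed V R 3 2 Y)}
    \<le> 4 * (real (card V))\<^sup>2 * (16 * (real (card V) * p\<^sup>2 + 2 * real (3 * m + 1) * p)) ^ m"
    (is "?L \<le> 4 * _ * (16 * ?\<alpha>) ^ m")
proof -
  have \<alpha>: "0 \<le> ?\<alpha>"
    using p by simp
  have "?L \<le> measure_pmf.prob (percolation ([V]\<^bsup>2\<^esup>) p) {R. \<exists>e\<in>[V]\<^bsup>2\<^esup>. {e} \<subseteq> R \<and>
      \<not> (\<exists>Y. e \<in> Y \<and> finite Y \<and> card Y \<le> 3 * m + 1 \<and> block_closed V R 3 2 Y)}"
    using V by (intro prob_percolation_mono) (auto simp: finite_imp_finite_nsets)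
  also have "\<dots> \<le> 4 * real (card ([V]\<^bsup>2\<^esup>)) * (16 * ?\<alpha>) ^ m"
  \<comment> \<open>Items are edges here, so the required edges are exactly the discovered
    items.\<close>
  proof (rule prob_no_small_block_closed_le[where I = "\<lambda>E X. E = X \<and> X \<subseteq> [V]\<^bsup>2\<^esup>"])
    fix E X :: "'a set set" and x assume "E = X \<and> X \<subseteq> [V]\<^bsup>2\<^esup>" "finite X" "card X \<le> 3 * m + 1" "x \<in> X"
    then show "(\<Sum>T\<in>{T\<in>[V]\<^bsup>3\<^esup>. x \<in> [T]\<^bsup>2\<^esup> \<and> \<not> [T]\<^bsup>2\<^esup> \<subseteq> X}. p ^ card ([T]\<^bsup>2\<^esup> - E)) \<le> ?\<alpha>"
      using triangle_step_le[OF V p, of X "3 * m + 1" x] by simp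
  qed (use V p \<alpha> in \<open>auto simp: finite_imp_finite_nsets choose_two nsets_def\<close>)
  also have "\<dots> \<le> 4 * (real (card V))\<^sup>2 * (16 * ?\<alpha>) ^ m"
  proof (intro mult_right_mono mult_left_mono)
    have "card ([V]\<^bsup>2\<^esup>) \<le> card V ^ 2"
      by (simp add: binomial_le_power)
    then show "real (card ([V]\<^bsup>2\<^esup>)) \<le> (real (card V))\<^sup>2"
      by (metis of_nat_le_iff of_nat_power)
  qed (use \<alpha> in auto)
  finally show ?thesis .
qed

lemma prob_K4_component_le:
  fixes p :: real and m :: nat
  assumes V: "finite V" and p: "0 \<le> p" "p \<le> 1"
  defines "M \<equiv> real (3 * m + 1)"
  shows "measure_pmf.prob (percolation ([V]\<^bsup>2\<^esup>) p)
      {R. \<exists>v\<in>V. \<not> (\<exists>Y. {v} \<in> Y \<and> finite Y \<and> card Y \<le> 3 * m + 1 \<and> block_closed V R 4 1 Y)}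
    \<le> 4 * real (card V) *
      (16 * (real (card V) ^ 3 * p ^ 6 + M * (real (card V) ^ 2 * p ^ 5) + M ^ 2 * (real (card V) * p ^ 3))) ^ m"
    (is "?L \<le> 4 * _ * (16 * ?\<alpha>) ^ m")
proof -
  have \<alpha>: "0 \<le> ?\<alpha>"
    using p by (simp add: M_def)
  have "?L \<le> measure_pmf.prob (percolation ([V]\<^bsup>2\<^esup>) p) {R. \<exists>x\<in>[V]\<^bsup>1\<^esup>. {} \<subseteq> R \<and>
      \<not> (\<exists>Y. x \<in> Y \<and> finite Y \<and> card Y \<le> 3 * m + 1 \<and> block_closed V R 4 1 Y)}"
    using V by (intro prob_percolation_mono) (auto simp: finite_imp_finite_nsets nsets_one)
  also have "\<dots> \<le> 4 * real (card ([V]\<^bsup>1\<^esup>)) * (16 * ?\<alpha>) ^ m"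
  \<comment> \<open>Items are single vertices here; the required edges are only known to lie among
    the discovered vertices.\<close>
  proof (rule prob_no_small_block_closed_le[where I = "\<lambda>E X. E \<subseteq> [\<Union>X]\<^bsup>2\<^esup> \<and> X \<subseteq> [V]\<^bsup>1\<^esup>"])
    fix E X :: "'a set set" and x assume "E \<subseteq> [\<Union>X]\<^bsup>2\<^esup> \<and> X \<subseteq> [V]\<^bsup>1\<^esup>" "finite X" "card X \<le> 3 * m + 1" "x \<in> X"
    then show "(\<Sum>T\<in>{T\<in>[V]\<^bsup>4\<^esup>. x \<in> [T]\<^bsup>1\<^esup> \<and> \<not> [T]\<^bsup>1\<^esup> \<subseteq> X}. p ^ card ([T]\<^bsup>2\<^esup> - E)) \<le> ?\<alpha>"
      unfolding M_def by (intro K4_step_le[OF V p]) auto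
  next
    fix E X x T assume EX: "E \<subseteq> [\<Union>X]\<^bsup>2\<^esup> \<and> X \<subseteq> [V]\<^bsup>1\<^esup>" and "T \<in> [V]\<^bsup>4\<^esup>"
    have "T \<subseteq> \<Union>([T]\<^bsup>1\<^esup>)"
      by (auto simp: nsets_one)
    moreover have "[\<Union>X]\<^bsup>2\<^esup> \<subseteq> [\<Union>(X \<union> [T]\<^bsup>1\<^esup>)]\<^bsup>2\<^esup>"
      by (intro nsets_mono) auto
    moreover have "[T]\<^bsup>2\<^esup> \<subseteq> [\<Union>(X \<union> [T]\<^bsup>1\<^esup>)]\<^bsup>2\<^esup>"
      using \<open>T \<subseteq> \<Union>([T]\<^bsup>1\<^esup>)\<close> by (intro nsets_mono) blast
    moreover have "[T]\<^bsup>1\<^esup> \<subseteq> [V]\<^bsup>1\<^esup>"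
      using \<open>T \<in> [V]\<^bsup>4\<^esup>\<close> by (intro nsets_mono) (auto simp: nsets_def)
    ultimately show "E \<union> [T]\<^bsup>2\<^esup> \<subseteq> [\<Union>(X \<union> [T]\<^bsup>1\<^esup>)]\<^bsup>2\<^esup> \<and> X \<union> [T]\<^bsup>1\<^esup> \<subseteq> [V]\<^bsup>1\<^esup>"
      using EX by blast
  qed (use V p \<alpha> in \<open>auto simp: finite_imp_finite_nsets\<close>)
  finally show ?thesis
    by simp
qed

text \<open>First moment over sets of \<open>s\<close> vertices and the \<open>5 * s / 2\<close>
  edges, rounded up, forced by minimum degree 5. The expectation is at most
  \<open>(n * y ^ 5) ^ s\<close>; the square root in \<open>y\<close> avoids half-integral powers of
  \<open>p\<close>, and \<open>y \<le> 1\<close> absorbs the rounding.\<close>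

lemma prob_not_sparse_upto_le:
  fixes p :: real
  assumes V: "finite V" and p: "0 \<le> p" "p \<le> 1"
    and y: "y = real M * sqrt p" "y \<le> 1" "real (card V) * y ^ 5 \<le> 1"
  shows "measure_pmf.prob (percolation ([V]\<^bsup>2\<^esup>) p) {R. \<not> sparse_upto V R M}
    \<le> real M * (real (card V) * y ^ 5)"
proof -
  let ?P = "\<lambda>Z. measure_pmf.prob (percolation ([V]\<^bsup>2\<^esup>) p) {R. Z R}"
  \<comment> \<open>the least number of edges on \<open>s\<close> vertices of degree at least 5\<close>
  let ?f = "\<lambda>s::nat. (5 * s + 1) div 2"
  let ?I = "SIGMA s:{1..M}. SIGMA S:[V]\<^bsup>s\<^esup>. [[S]\<^bsup>2\<^esup>]\<^bsup>?f s\<^esup>"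
  have finI: "finite (SIGMA S:[V]\<^bsup>s\<^esup>. [[S]\<^bsup>2\<^esup>]\<^bsup>?f s\<^esup>)" for s
    using V by (intro finite_SigmaI) (auto simp: finite_imp_finite_nsets nsets_def)
  have y0: "0 \<le> y" "y ^ 2 = (real M) ^ 2 * p"
    using p by (auto simp: y(1) power_mult_distrib)
  have "?P (\<lambda>R. \<not> sparse_upto V R M) \<le> (\<Sum>i\<in>?I. ?P (\<lambda>R. snd (snd i) \<subseteq> R))"
  proof (rule prob_percolation_union_bound)
    fix R assume R: "R \<subseteq> [V]\<^bsup>2\<^esup>" and "\<not> sparse_upto V R M"
    then obtain S where S: "S \<subseteq> V" "S \<noteq> {}" "card S \<le> M"
      and deg: "\<And>v. v \<in> S \<Longrightarrow> \<not> card {w \<in> S. w \<noteq> v \<and> {v, w} \<in> R} \<le> 4"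
      unfolding sparse_upto_def by blast
    have finS: "finite S"
      using S V finite_subset by blast
    have "5 * card S = (\<Sum>v\<in>S. 5)"
      by simp
    also have "\<dots> \<le> (\<Sum>v\<in>S. card {w \<in> S. {v, w} \<in> R \<inter> [S]\<^bsup>2\<^esup>})"
    proof (rule sum_mono)
      fix v assume v: "v \<in> S"
      then have "{w \<in> S. w \<noteq> v \<and> {v, w} \<in> R} = {w \<in> S. {v, w} \<in> R \<inter> [S]\<^bsup>2\<^esup>}"
        by auto
      then show "5 \<le> card {w \<in> S. {v, w} \<in> R \<inter> [S]\<^bsup>2\<^esup>}"
        using deg[OF v] by simp
    qed
    also have "\<dots> = 2 * card (R \<inter> [S]\<^bsup>2\<^esup>)"
      using finS by (intro sum_card_neighbours) auto
    finally have "?f (card S) \<le> card (R \<inter> [S]\<^bsup>2\<^esup>)"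
      by linarith
    then obtain F where F: "F \<subseteq> R \<inter> [S]\<^bsup>2\<^esup>" "card F = ?f (card S)" "finite F"
      using obtain_subset_with_card_n by blast
    have "card S > 0"
      using S finS by (simp add: card_gt_0_iff)
    then have "(card S, S, F) \<in> ?I"
      using S F finS by (auto simp: nsets_def)
    then show "\<exists>i\<in>?I. snd (snd i) \<subseteq> R"
      using F by (intro bexI[of _ "(card S, S, F)"]) auto
  qed (use V finI in \<open>auto simp: finite_imp_finite_nsets\<close>)
  also have "\<dots> = (\<Sum>s\<in>{1..M}. \<Sum>i\<in>(SIGMA S:[V]\<^bsup>s\<^esup>. [[S]\<^bsup>2\<^esup>]\<^bsup>?f s\<^esup>). ?P (\<lambda>R. snd i \<subseteq> R))"
    using finI by (subst sum.Sigma) (auto simp: case_prod_beta)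
  also have "\<dots> \<le> (\<Sum>s\<in>{1..M}. real (card V) * y ^ 5)"
  proof (rule sum_mono)
    fix s assume s: "s \<in> {1..M}"
    let ?S = "SIGMA S:[V]\<^bsup>s\<^esup>. [[S]\<^bsup>2\<^esup>]\<^bsup>?f s\<^esup>"
    have "(\<Sum>i\<in>?S. ?P (\<lambda>R. snd i \<subseteq> R)) \<le> (\<Sum>i\<in>?S. p ^ ?f s)"
    proof (rule sum_mono)
      fix i assume "i \<in> ?S"
      then have "finite (snd i)" "card (snd i) = ?f s"
        by (auto simp: nsets_def)
      then show "?P (\<lambda>R. snd i \<subseteq> R) \<le> p ^ ?f s"
        using prob_percolation_superset_le[of "[V]\<^bsup>2\<^esup>" "snd i" p] V p by (simp add: finite_imp_finite_nsets)
    qed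
    also have "\<dots> = real (card ?S) * p ^ ?f s"
      by simp
    also have "\<dots> \<le> (real (card V) ^ s * (real M ^ 2) ^ ?f s) * p ^ ?f s"
    proof (intro mult_right_mono)
      have "card ?S = (\<Sum>S\<in>[V]\<^bsup>s\<^esup>. card ([[S]\<^bsup>2\<^esup>]\<^bsup>?f s\<^esup>))"
        using V by (intro card_SigmaI) (auto simp: finite_imp_finite_nsets nsets_def)
      also have "\<dots> \<le> (\<Sum>S\<in>[V]\<^bsup>s\<^esup>. (M ^ 2) ^ ?f s)"
      proof (rule sum_mono)
        fix S assume "S \<in> [V]\<^bsup>s\<^esup>"
        then have "card S = s"
          by (simp add: nsets_def)
        have "card ([[S]\<^bsup>2\<^esup>]\<^bsup>?f s\<^esup>) \<le> (card S ^ 2) ^ ?f s"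
          using binomial_le_power[of "card S choose 2" "?f s"]
            power_mono[OF binomial_le_power[of "card S" 2], of "?f s"] by simp
        also have "\<dots> \<le> (M ^ 2) ^ ?f s"
          using s \<open>card S = s\<close> by (intro power_mono) auto
        finally show "card ([[S]\<^bsup>2\<^esup>]\<^bsup>?f s\<^esup>) \<le> (M ^ 2) ^ ?f s" .
      qed
      also have "\<dots> = (card V choose s) * (M ^ 2) ^ ?f s"
        by simp
      also have "\<dots> \<le> card V ^ s * (M ^ 2) ^ ?f s"
        by (simp add: binomial_le_power)
      finally have "real (card ?S) \<le> real (card V ^ s * (M ^ 2) ^ ?f s)"
        by (simp only: of_nat_le_iff)
      then show "real (card ?S) \<le> real (card V) ^ s * (real M ^ 2) ^ ?f s"
        by simp
    qed (use p in auto)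
    also have "\<dots> = real (card V) ^ s * y ^ (2 * ?f s)"
      by (simp only: power_mult y0(2) power_mult_distrib mult.assoc)
    also have "\<dots> \<le> real (card V) ^ s * y ^ (5 * s)"
      using y0 y by (intro mult_left_mono power_decreasing) auto
    also have "\<dots> = (real (card V) * y ^ 5) ^ s"
      by (simp add: power_mult power_mult_distrib)
    also have "\<dots> \<le> (real (card V) * y ^ 5) ^ 1"
      using s y y0 by (intro power_decreasing) auto
    finally show "(\<Sum>i\<in>?S. ?P (\<lambda>R. snd i \<subseteq> R)) \<le> real (card V) * y ^ 5"
      by simp
  qed
  also have "\<dots> = real M * (real (card V) * y ^ 5)"
    by simp
  finally show ?thesis .
qed

subsection \<open>The bipartite host graph\<close>

lemma sparse_upto_mono: "sparse_upto V R M \<Longrightarrow> k \<le> M \<Longrightarrow> sparse_upto V R k"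
  unfolding sparse_upto_def
proof (intro allI impI)
  fix S
  assume sparse: "\<forall>S\<subseteq>V. S \<noteq> {} \<longrightarrow> card S \<le> M \<longrightarrow> (\<exists>v\<in>S. card {w \<in> S. w \<noteq> v \<and> {v, w} \<in> R} \<le> 4)"
    and "k \<le> M" and S: "S \<subseteq> V" "S \<noteq> {}" "card S \<le> k"
  then have "card S \<le> M"
    by simp
  then show "\<exists>v\<in>S. card {w \<in> S. w \<noteq> v \<and> {v, w} \<in> R} \<le> 4"
    using sparse S by simp
qed

text \<open>Components of \<open>k\<close> edges span up to \<open>2 * k\<close> vertices, those of
  \<open>k\<close> singletons only \<open>k\<close>; the sparsity bound covers both.\<close>

lemma not_ramsey_arrow_of_small_components:
  assumes V: "finite V" "V = A \<union> B" "A \<inter> B = {}" and R: "R \<subseteq> [V]\<^bsup>2\<^esup>"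
    and sparse: "sparse_upto V R (2 * k)"
    and K3: "\<And>e. e \<in> R \<Longrightarrow> \<exists>Y. e \<in> Y \<and> finite Y \<and> card Y \<le> k \<and> block_closed V R 3 2 Y"
    and K4: "\<And>v. v \<in> V \<Longrightarrow> \<exists>Y. {v} \<in> Y \<and> finite Y \<and> card Y \<le> k \<and> block_closed V R 4 1 Y"
  shows "\<not> ramsey_arrow V (complete_bipartite A B \<union> R) 4"
proof -
  obtain c :: "'a set \<Rightarrow> bool" where c:
    "\<And>T. T \<in> [V]\<^bsup>3\<^esup> \<Longrightarrow> [T]\<^bsup>2\<^esup> \<subseteq> R \<Longrightarrow> \<exists>e\<in>[T]\<^bsup>2\<^esup>. \<exists>f\<in>[T]\<^bsup>2\<^esup>. c e \<noteq> c f"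
    by (rule triangle_free_colouring[OF V(1) sparse R K3]) (assumption | rule that)+
  have "sparse_upto V R k"
    using sparse by (rule sparse_upto_mono) simp
  then obtain W where W:
    "\<And>T. T \<in> [V]\<^bsup>4\<^esup> \<Longrightarrow> [T]\<^bsup>2\<^esup> \<subseteq> R \<Longrightarrow> card (T \<inter> W) \<le> 2 \<and> card (T - W) \<le> 3"
    by (rule K4_splitting_set[OF V(1) _ K4]) (assumption | rule that)+
  have "A \<subseteq> V" "B \<subseteq> V"
    using V by auto
  show ?thesis
    unfolding V(2)
  proof (rule bipartite_not_ramsey_arrow[OF V(3)])
    fix T assume "T \<in> [A]\<^bsup>3\<^esup>" "[T]\<^bsup>2\<^esup> \<subseteq> R"
    then show "\<exists>e\<in>[T]\<^bsup>2\<^esup>. \<exists>f\<in>[T]\<^bsup>2\<^esup>. c e \<noteq> c f"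
      using nsets_mono[OF \<open>A \<subseteq> V\<close>] by (intro c) auto
  next
    fix T assume "T \<in> [B]\<^bsup>4\<^esup>" "[T]\<^bsup>2\<^esup> \<subseteq> R"
    then show "card (T \<inter> W) \<le> 2 \<and> card (T - W) \<le> 3"
      using nsets_mono[OF \<open>B \<subseteq> V\<close>] by (intro W) auto
  qed
qed

lemma prob_bipartite_ramsey_arrow_le:
  fixes p y :: real and m :: nat
  assumes V: "finite V" "V = A \<union> B" "A \<inter> B = {}" and p: "0 \<le> p" "p \<le> 1"
  defines "M \<equiv> real (3 * m + 1)" and "n \<equiv> real (card V)"
  assumes y: "y = 2 * M * sqrt p" "y \<le> 1" "n * y ^ 5 \<le> 1"
  shows "measure_pmf.prob (percolation ([V]\<^bsup>2\<^esup>) p) {R. ramsey_arrow V (complete_bipartite A B \<union> R) 4}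
    \<le> 2 * M * (n * y ^ 5) + 4 * n\<^sup>2 * (16 * (n * p\<^sup>2 + 2 * M * p)) ^ m
      + 4 * n * (16 * (n ^ 3 * p ^ 6 + M * (n ^ 2 * p ^ 5) + M ^ 2 * (n * p ^ 3))) ^ m"
proof -
  let ?P = "\<lambda>Z. measure_pmf.prob (percolation ([V]\<^bsup>2\<^esup>) p) {R. Z R}"
  let ?k = "3 * m + 1"
  define small where "small = (\<lambda>R r q x. \<exists>Y. x \<in> Y \<and> finite Y \<and> card Y \<le> ?k \<and> block_closed V R r q Y)"
  let ?Z = "\<lambda>i R. if i = (0::nat) then \<not> sparse_upto V R (2 * ?k)
    else if i = 1 then \<exists>e\<in>R. \<not> small R 3 2 e else \<exists>v\<in>V. \<not> small R 4 1 {v}"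
  have "?P (\<lambda>R. ramsey_arrow V (complete_bipartite A B \<union> R) 4) \<le> (\<Sum>i\<in>{0, 1, 2}. ?P (?Z i))"
  proof (rule prob_percolation_union_bound)
    fix R assume R: "R \<subseteq> [V]\<^bsup>2\<^esup>" and arrow: "ramsey_arrow V (complete_bipartite A B \<union> R) 4"
    show "\<exists>i\<in>{0, 1, 2}. ?Z i R"
    proof (rule ccontr)
      assume "\<not> ?thesis"
      then have "\<not> ?Z 0 R" "\<not> ?Z 1 R" "\<not> ?Z 2 R"
        by blast+
      then have "sparse_upto V R (2 * ?k)" "\<And>e. e \<in> R \<Longrightarrow> small R 3 2 e" "\<And>v. v \<in> V \<Longrightarrow> small R 4 1 {v}"
        by simp_all
      then show False
        using not_ramsey_arrow_of_small_components[OF V R] arrow unfolding small_def by blast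
    qed
  qed (use V in \<open>auto simp: finite_imp_finite_nsets\<close>)
  also have "\<dots> = ?P (?Z 0) + ?P (?Z 1) + ?P (?Z 2)"
    by simp
  also have "\<dots> \<le> real (2 * ?k) * (n * y ^ 5) + 4 * n\<^sup>2 * (16 * (n * p\<^sup>2 + 2 * M * p)) ^ m
      + 4 * n * (16 * (n ^ 3 * p ^ 6 + M * (n ^ 2 * p ^ 5) + M ^ 2 * (n * p ^ 3))) ^ m"
    using prob_not_sparse_upto_le[OF V(1) p, of y "2 * ?k" ] y
      prob_triangle_component_le[OF V(1) p, of m] prob_K4_component_le[OF V(1) p, of m]
    unfolding M_def n_def small_def by (intro add_mono) auto
  finally show ?thesis
    unfolding M_def by simp
qed

text \<open>Since \<open>exp 3 \<le> 27\<close>, the base is at most \<open>exp (- 3)\<close>. The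
  resulting \<open>1 / n^3\<close> beats the at most \<open>n^2\<close> starting items of a
  search.\<close>

lemma power_ceiling_ln_le:
  fixes x :: real
  assumes n: "n > 0" and x: "0 \<le> x" "x \<le> 1/27"
  shows "x ^ nat \<lceil>ln (real n)\<rceil> \<le> 1 / real n ^ 3"
proof -
  let ?m = "nat \<lceil>ln (real n)\<rceil>"
  have "exp 3 \<le> (27 :: real)"
    using power_mono[OF exp_le, of 3] exp_of_nat_mult[of 3 "1 :: real"] by simp
  then have "x \<le> exp (- 3)"
    using x by (simp add: exp_minus field_simps) (meson order_trans mult_left_mono)
  then have "x ^ ?m \<le> exp (- 3) ^ ?m"
    using x by (intro power_mono)
  also have "\<dots> = exp (- 3 * real ?m)"
    by (simp add: exp_of_nat_mult[symmetric] mult.commute)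
  also have "\<dots> \<le> exp (- 3 * ln (real n))"
    using real_nat_ceiling_ge[of "ln (real n)"] by simp
  also have "\<dots> = 1 / real n ^ 3"
    using n by (simp add: exp_minus exp_of_nat_mult[of 3, simplified] field_simps)
  finally show ?thesis .
qed

lemma aas_bipartite_not_ramsey_arrow:
  fixes p :: "nat \<Rightarrow> real"
  assumes p: "\<And>n. 0 \<le> p n \<and> p n \<le> 1"
    and p_le: "\<forall>\<^sub>F n in sequentially. p n \<le> real n powr (- 1/2) / 100"
  shows "(\<lambda>n. measure_pmf.prob (binomial_random_graph {..<n} (p n))
    {R. ramsey_arrow {..<n} (complete_bipartite {..<n div 2} {n div 2..<n} \<union> R) 4}) \<longlonglongrightarrow> 0"
proof (rule tendsto_sandwich[OF _ _ tendsto_const])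
  define q where "q = (\<lambda>n::nat. real n powr (- 1/2) / 100)"
  \<comment> \<open>Upper bound for \<open>3 * m + 1\<close> with \<open>m\<close> the ceiling of
    \<open>ln n\<close>.\<close>
  define L where "L = (\<lambda>n::nat. 3 * ln (real n) + 4)"
  define y where "y = (\<lambda>n. 2 * L n * sqrt (q n))"
  have "\<forall>\<^sub>F n in sequentially. y n \<le> 1"
    unfolding y_def L_def q_def by real_asymp
  moreover have "\<forall>\<^sub>F n in sequentially. real n * y n ^ 5 \<le> 1"
    unfolding y_def L_def q_def by real_asymp
  moreover have "(\<lambda>n. real n * q n ^ 2 + 2 * L n * q n) \<longlonglongrightarrow> (1 / 100)\<^sup>2"
    unfolding L_def q_def by real_asymp
  \<comment> \<open>The threshold is \<open>1/27\<close> divided by the 16 of the pattern count; the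
    constant \<open>1/100\<close> in \<open>q\<close> puts both limits below it.\<close>
  then have "\<forall>\<^sub>F n in sequentially. real n * q n ^ 2 + 2 * L n * q n < 1 / 432"
    by (rule order_tendstoD) (simp add: power_divide)
  moreover have "(\<lambda>n. real n ^ 3 * q n ^ 6 + L n * (real n ^ 2 * q n ^ 5) + L n ^ 2 * (real n * q n ^ 3))
      \<longlonglongrightarrow> (1 / 100) ^ 6"
    unfolding L_def q_def by real_asymp
  then have "\<forall>\<^sub>F n in sequentially.
      real n ^ 3 * q n ^ 6 + L n * (real n ^ 2 * q n ^ 5) + L n ^ 2 * (real n * q n ^ 3) < 1 / 432"
    by (rule order_tendstoD) (simp add: power_divide)
  ultimately show "\<forall>\<^sub>F n in sequentially. measure_pmf.prob (binomial_random_graph {..<n} (p n))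
    {R. ramsey_arrow {..<n} (complete_bipartite {..<n div 2} {n div 2..<n} \<union> R) 4}
    \<le> 2 * L n * (real n * y n ^ 5) + 8 / real n"
    using p_le eventually_ge_at_top[of 1]
  proof eventually_elim
    case (elim n)
    define m where "m = nat \<lceil>ln (real n)\<rceil>"
    define M where "M = real (3 * m + 1)"
    define z where "z = 2 * M * sqrt (p n)"
    have n: "n > 0"
      using elim by simp
    have pq: "0 \<le> p n" "p n \<le> q n"
      using p elim(5) by (auto simp: q_def)
    have M: "0 \<le> M" "M \<le> L n"
    proof -
      show "0 \<le> M"
        by (simp add: M_def)
      have "0 \<le> ln (real n)"
        using n by simp
      then have "real m \<le> ln (real n) + 1"
        using ceiling_correct[of "ln (real n)"] unfolding m_def by linarith
      then show "M \<le> L n"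
        by (simp add: M_def L_def)
    qed
    have z: "0 \<le> z" "z \<le> y n"
      using pq M unfolding z_def y_def by (auto intro!: mult_mono)
    have ny: "real n * z ^ 5 \<le> real n * y n ^ 5"
      using z by (intro mult_left_mono power_mono) auto
    have "measure_pmf.prob (percolation ([{..<n}]\<^bsup>2\<^esup>) (p n))
        {R. ramsey_arrow {..<n} (complete_bipartite {..<n div 2} {n div 2..<n} \<union> R) 4}
      \<le> 2 * M * (real (card {..<n}) * z ^ 5)
        + 4 * (real (card {..<n}))\<^sup>2 * (16 * (real (card {..<n}) * p n ^ 2 + 2 * M * p n)) ^ m
        + 4 * real (card {..<n}) * (16 * (real (card {..<n}) ^ 3 * p n ^ 6
          + M * (real (card {..<n}) ^ 2 * p n ^ 5) + M ^ 2 * (real (card {..<n}) * p n ^ 3))) ^ m"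
      unfolding M_def using p elim(1,2) z(2) ny
      by (intro prob_bipartite_ramsey_arrow_le) (auto simp: z_def M_def)
    also have "\<dots> = 2 * M * (real n * z ^ 5)
        + 4 * (real n)\<^sup>2 * (16 * (real n * p n ^ 2 + 2 * M * p n)) ^ m
        + 4 * real n * (16 * (real n ^ 3 * p n ^ 6 + M * (real n ^ 2 * p n ^ 5) + M ^ 2 * (real n * p n ^ 3))) ^ m"
      by simp
    also have "\<dots> \<le> 2 * L n * (real n * y n ^ 5) + 4 * (real n)\<^sup>2 * (1 / real n ^ 3) + 4 * real n * (1 / real n ^ 3)"
    proof (intro add_mono mult_left_mono)
      show "2 * M * (real n * z ^ 5) \<le> 2 * L n * (real n * y n ^ 5)"
        using M z ny by (intro mult_mono) auto
      have "real n * p n ^ 2 + 2 * M * p n \<le> real n * q n ^ 2 + 2 * L n * q n"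
        using pq M by (intro add_mono mult_mono power_mono) auto
      then show "(16 * (real n * p n ^ 2 + 2 * M * p n)) ^ m \<le> 1 / real n ^ 3"
        unfolding m_def using elim(3) pq M by (intro power_ceiling_ln_le n) auto
      have "real n ^ 3 * p n ^ 6 + M * (real n ^ 2 * p n ^ 5) + M ^ 2 * (real n * p n ^ 3)
          \<le> real n ^ 3 * q n ^ 6 + L n * (real n ^ 2 * q n ^ 5) + L n ^ 2 * (real n * q n ^ 3)"
        using pq M by (intro add_mono mult_mono power_mono) auto
      then show "(16 * (real n ^ 3 * p n ^ 6 + M * (real n ^ 2 * p n ^ 5) + M ^ 2 * (real n * p n ^ 3))) ^ m
          \<le> 1 / real n ^ 3"
        unfolding m_def using elim(4) pq M by (intro power_ceiling_ln_le n) auto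
    qed auto
    also have "\<dots> \<le> 2 * L n * (real n * y n ^ 5) + 8 / real n"
    proof -
      have "4 * (real n)\<^sup>2 * (1 / real n ^ 3) = 4 / real n"
        using n by (simp add: power2_eq_square power3_eq_cube)
      moreover have "4 * real n * (1 / real n ^ 3) = 4 / real n * (1 / real n)"
        using n by (simp add: power3_eq_cube)
      moreover have "4 / real n * (1 / real n) \<le> 4 / real n * 1"
        using n by (intro mult_left_mono) auto
      ultimately show ?thesis
        by linarith
    qed
    finally show ?case
      by (simp add: binomial_random_graph_percolation)
  qed
  show "(\<lambda>n. 2 * L n * (real n * y n ^ 5) + 8 / real n) \<longlonglongrightarrow> 0"
    unfolding y_def L_def q_def by real_asymp
qed simp

section \<open>Edge counts for the host graph\<close>

lemma card_complete_bipartite: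
  assumes "finite A" "finite B" "A \<inter> B = {}"
  shows "card (complete_bipartite A B) = card A * card B"
  unfolding complete_bipartite_def
  using assms by (subst card_image) (auto simp: inj_on_def doubleton_eq_iff card_cartesian_product)

lemma complete_bipartite_subset: "A \<inter> B = {} \<Longrightarrow> complete_bipartite A B \<subseteq> [A \<union> B]\<^bsup>2\<^esup>"
  by (auto simp: complete_bipartite_def)

lemma card_balanced_complete_bipartite_ge:
  "((real n)\<^sup>2 - 1) / 4 \<le> real (card (complete_bipartite {..<n div 2} {n div 2..<n}))"
proof -
  have "card (complete_bipartite {..<n div 2} {n div 2..<n}) = (n div 2) * (n - n div 2)"
    by (subst card_complete_bipartite) auto
  moreover have "n ^ 2 \<le> 4 * ((n div 2) * (n - n div 2)) + 1"
  proof (cases "even n")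
    case True
    then obtain k where "n = 2 * k" ..
    then show ?thesis
      by (simp add: power2_eq_square)
  next
    case False
    then obtain k where "n = 2 * k + 1"
      using oddE by blast
    then show ?thesis
      by (simp add: power2_eq_square algebra_simps)
  qed
  then have "(real n)\<^sup>2 \<le> 4 * real ((n div 2) * (n - n div 2)) + 1"
    by (simp only: of_nat_power[symmetric] of_nat_le_iff[where 'a = real, symmetric] of_nat_add of_nat_mult of_nat_numeral of_nat_1)
  ultimately show ?thesis
    by simp
qed

lemma card_nsets_2_ge:
  assumes "2 \<le> n"
  shows "(real n)\<^sup>2 / 4 \<le> real (card ([{..<n}]\<^bsup>2\<^esup>))"
proof -
  have "real (n choose 2) = real n * (real n - 1) / 2"
    using assms by (simp add: choose_two real_of_nat_div of_nat_diff)
  moreover have "real n * 2 \<le> real n * real n"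
    using assms by (intro mult_left_mono) auto
  ultimately show ?thesis
    by (simp add: power2_eq_square algebra_simps)
qed

theorem theorem1p5:
  shows
    "(\<forall>(\<gamma>::real) (\<epsilon>::real) (p :: nat \<Rightarrow> real).
        0 < \<gamma> \<longrightarrow> 0 < \<epsilon> \<longrightarrow>
        (\<forall>n. 0 \<le> p n \<and> p n \<le> 1) \<longrightarrow>
        (\<forall>\<^sub>F n in sequentially. p n \<ge> real n powr (- 1 / 2 + \<epsilon>)) \<longrightarrow>
        (\<forall>\<delta>>0. \<forall>\<^sub>F n in sequentially.
           \<forall>G. simple_graph {..<n} G \<and> real (card G) \<ge> \<gamma> * (real n)\<^sup>2 \<longrightarrow>
             measure_pmf.prob (binomial_random_graph {..<n} (p n))
               {R. ramsey_arrow {..<n} (G \<union> R) 4} > 1 - \<delta>))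
     \<and>
     (\<forall>\<gamma>::real. 0 < \<gamma> \<and> \<gamma> < 1 / 4 \<longrightarrow>
        (\<exists>G :: nat \<Rightarrow> nat set set.
           (\<forall>n. simple_graph {..<n} (G n)) \<and>
           (\<forall>n\<ge>2. real (card (G n)) \<ge> \<gamma> * (real n)\<^sup>2) \<and>
           (\<forall>p :: nat \<Rightarrow> real.
              (\<forall>n. 0 \<le> p n \<and> p n \<le> 1) \<longrightarrow>
              p \<in> o(\<lambda>n. real n powr (- 1 / 2)) \<longrightarrow>
              (\<lambda>n. measure_pmf.prob (binomial_random_graph {..<n} (p n))
                 {R. \<not> ramsey_arrow {..<n} (G n \<union> R) 4}) \<longlonglongrightarrow> 1)))"
proof (rule conjI; intro allI impI, (elim conjE)?)
  fix \<gamma> \<epsilon> \<delta> :: real and p :: "nat \<Rightarrow> real"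
  assume "0 < \<gamma>" "0 < \<epsilon>" "\<forall>n. 0 \<le> p n \<and> p n \<le> 1" "0 < \<delta>"
    "\<forall>\<^sub>F n in sequentially. p n \<ge> real n powr (- 1 / 2 + \<epsilon>)"
  then show "\<forall>\<^sub>F n in sequentially. \<forall>G. simple_graph {..<n} G \<and> real (card G) \<ge> \<gamma> * (real n)\<^sup>2 \<longrightarrow>
      measure_pmf.prob (binomial_random_graph {..<n} (p n)) {R. ramsey_arrow {..<n} (G \<union> R) 4} > 1 - \<delta>"
    by (intro prob_dense_arrow) auto
next
  fix \<gamma> :: real
  assume \<gamma>: "0 < \<gamma>" "\<gamma> < 1 / 4"
  let ?B = "\<lambda>n::nat. complete_bipartite {..<n div 2} {n div 2..<n}"
  \<comment> \<open>For small \<open>n\<close> the bipartite graph may have fewer than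
    \<open>\<gamma> * n^2\<close> edges; the complete graph then meets the bound for all
    \<open>n \<ge> 2\<close>. Since \<open>\<gamma> < 1/4\<close>, this happens only finitely often
    and does not affect the limit.\<close>
  define G where "G = (\<lambda>n. if \<gamma> * (real n)\<^sup>2 \<le> real (card (?B n)) then ?B n else [{..<n}]\<^bsup>2\<^esup>)"
  have ev: "\<forall>\<^sub>F n in sequentially. G n = ?B n"
  proof -
    have "\<forall>\<^sub>F n in sequentially. \<gamma> * (real n)\<^sup>2 \<le> ((real n)\<^sup>2 - 1) / 4"
      using \<gamma> by real_asymp
    then show ?thesis
    proof eventually_elim
      case (elim n)
      then show ?case
        using card_balanced_complete_bipartite_ge[of n] unfolding G_def by auto
    qed
  qed
  show "\<exists>G. (\<forall>n. simple_graph {..<n} (G n)) \<and> (\<forall>n\<ge>2. real (card (G n)) \<ge> \<gamma> * (real n)\<^sup>2) \<and>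
     (\<forall>p :: nat \<Rightarrow> real. (\<forall>n. 0 \<le> p n \<and> p n \<le> 1) \<longrightarrow> p \<in> o(\<lambda>n. real n powr (- 1 / 2)) \<longrightarrow>
        (\<lambda>n. measure_pmf.prob (binomial_random_graph {..<n} (p n))
           {R. \<not> ramsey_arrow {..<n} (G n \<union> R) 4}) \<longlonglongrightarrow> 1)"
  proof (intro exI[of _ G] conjI allI impI)
    fix n :: nat
    have disjoint: "{..<n div 2} \<inter> {n div 2..<n} = {}" and union: "{..<n div 2} \<union> {n div 2..<n} = {..<n}"
      by auto
    have "?B n \<subseteq> [{..<n}]\<^bsup>2\<^esup>"
      using complete_bipartite_subset[OF disjoint] unfolding union .
    then show "simple_graph {..<n} (G n)"
      by (simp add: simple_graph_def G_def)
  next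
    fix n :: nat assume "2 \<le> n"
    have "\<gamma> * (real n)\<^sup>2 \<le> 1/4 * (real n)\<^sup>2"
      using \<gamma> by (intro mult_right_mono) auto
    then show "\<gamma> * (real n)\<^sup>2 \<le> real (card (G n))"
      using card_nsets_2_ge[OF \<open>2 \<le> n\<close>] unfolding G_def by auto
  next
    fix p :: "nat \<Rightarrow> real"
    assume p: "\<forall>n. 0 \<le> p n \<and> p n \<le> 1" and o: "p \<in> o(\<lambda>n. real n powr (- 1 / 2))"
    let ?Q = "\<lambda>n. measure_pmf.prob (binomial_random_graph {..<n} (p n))"
    have "\<forall>\<^sub>F n in sequentially. norm (p n) \<le> 1/100 * norm (real n powr (- 1 / 2))"
      using o by (rule landau_o.smallD) simp
    then have "\<forall>\<^sub>F n in sequentially. p n \<le> real n powr (- 1/2) / 100"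
      using p by (auto elim!: eventually_mono)
    then have "(\<lambda>n. ?Q n {R. ramsey_arrow {..<n} (?B n \<union> R) 4}) \<longlonglongrightarrow> 0"
      using p by (intro aas_bipartite_not_ramsey_arrow) auto
    then have "(\<lambda>n. 1 - ?Q n {R. ramsey_arrow {..<n} (?B n \<union> R) 4}) \<longlonglongrightarrow> 1 - 0"
      by (intro tendsto_intros)
    moreover have "1 - ?Q n {R. ramsey_arrow {..<n} (?B n \<union> R) 4}
        = ?Q n {R. \<not> ramsey_arrow {..<n} (?B n \<union> R) 4}" for n
      by (subst measure_pmf.prob_compl[symmetric]) (auto intro!: arg_cong2[of _ _ _ _ measure])
    ultimately have lim: "(\<lambda>n. ?Q n {R. \<not> ramsey_arrow {..<n} (?B n \<union> R) 4}) \<longlonglongrightarrow> 1"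
      by simp
    have "\<forall>\<^sub>F n in sequentially. ?Q n {R. \<not> ramsey_arrow {..<n} (G n \<union> R) 4}
        = ?Q n {R. \<not> ramsey_arrow {..<n} (?B n \<union> R) 4}"
      using ev by (auto elim!: eventually_mono)
    then show "(\<lambda>n. ?Q n {R. \<not> ramsey_arrow {..<n} (G n \<union> R) 4}) \<longlonglongrightarrow> 1"
      using lim by (simp add: tendsto_cong)
  qed
qed

end
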